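(* Let $q$ be a prime power, $n\geq 4$ an integer, $m$ a positive divisor of $q^n-1$, and $\beta\in\mathbb{F}_{q^n}$ an element that is $2$-normal over $\mathbb{F}_q$ and such that $\beta\notin\mathbb{F}_{q^d}$ for every divisor $d<n$ of $n$. Let $N_\beta(m)$ be the number of elements $a\in\mathbb{F}_q$ such that $a+\beta$ is $m$-free. If $q^{1/2}\geq (n-1)W(m)$, then $N_\beta(m)>0$.
   Context: For $\alpha\in\mathbb{F}_{q^n}$ let $g_\alpha(x)=\sum_{i=0}^{n-1}\alpha^{q^i}x^{n-1-i}$; $\alpha$ is $k$-normal over $\mathbb{F}_q$ if $\gcd(x^n-1,g_\alpha(x))$ in $\mathbb{F}_{q^n}[x]$ has degree $k$. For $m\mid q^n-1$, an element $\gamma\in\mathbb{F}_{q^n}^*$ is $m$-free if $\gamma=\eta^d$ with $\eta\in\mathbb{F}_{q^n}$ and $d$ a positive divisor of $m$ implies $d=1$. $W(m)$ is the number of square-free positive divisors of $m$. *)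

theory Defs
  imports "HOL-Computational_Algebra.Computational_Algebra"
begin

text \<open>The ambient field F_{q^n} is a finite field type 'a with CARD('a) = q^n.
  The subfield F_{q^d} (for d dividing n) is the set of roots of x^(q^d) - x.\<close>

definition subfield_pow :: "nat \<Rightarrow> nat \<Rightarrow> 'a::field set" where
  "subfield_pow q d = {x. x ^ (q ^ d) = x}"

definition g_poly :: "nat \<Rightarrow> nat \<Rightarrow> 'a::field \<Rightarrow> 'a poly" where
  "g_poly q n \<alpha> = (\<Sum>i<n. monom (\<alpha> ^ (q ^ i)) (n - 1 - i))"

definition k_normal :: "nat \<Rightarrow> nat \<Rightarrow> nat \<Rightarrow> 'a::field_gcd \<Rightarrow> bool" where
  "k_normal q n k \<alpha> \<longleftrightarrow> degree (gcd (monom 1 n - 1) (g_poly q n \<alpha>)) = k"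

definition m_free :: "nat \<Rightarrow> 'a::field \<Rightarrow> bool" where
  "m_free m \<gamma> \<longleftrightarrow> \<gamma> \<noteq> 0 \<and>
     (\<forall>(\<eta>::'a) d. d > 0 \<and> d dvd m \<and> \<gamma> = \<eta> ^ d \<longrightarrow> d = 1)"

definition W :: "nat \<Rightarrow> nat" where
  "W m = card {d. d dvd m \<and> squarefree d}"

end

theory Submission
  imports
    "HOL-Algebra.Algebraic_Closure_Type"
    "HOL-Analysis.Kronecker_Approximation_Theorem"
    "HOL-Number_Theory.Residues"
    Defs
begin

text \<open>
  The heart of the matter is the Weil bound \<open>\<bar>\<Sum> \<psi>(a + \<beta>)\<bar> \<le> (n - 1) \<surd>q\<close>, the sum running over \<open>a\<close> in
  \<open>F\<^sub>q\<close>, for a nontrivial multiplicative character \<open>\<psi>\<close> of \<open>F\<^bsub>q^n\<^esub>\<close>. Sending a monic polynomial \<open>f\<close>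
  over \<open>F\<^sub>q\<close> to \<open>\<psi>(f(\<beta>))\<close> is completely multiplicative, and its L-function is a polynomial of degree
  less than \<open>n\<close>, because \<open>f(\<beta>)\<close> is equidistributed once \<open>deg f \<ge> n\<close>. Comparing with the Euler
  product, the power sums of its reciprocal roots are, up to sign, the analogous character sums over
  \<open>F\<^bsub>q^r\<^esub>\<close>. For \<open>r = 2ns\<close> these sums are \<open>O(q\<^bsup>r/2\<^esup>)\<close> as \<open>s\<close> grows: they count, weighted by \<open>\<psi>\<close>,
  points on twists of a curve \<open>y\<^sup>d = f(x)\<close> with \<open>d = q\<^sup>n - 1\<close> and \<open>deg f\<close> prime to \<open>d\<close>, and Bombieri's
  form of Stepanov's method bounds these counts from above; since all twists together exhaust
  the field, upper bounds suffice. Hence all reciprocal roots have modulus at most \<open>\<surd>q\<close>.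

  The theorem follows by expanding the product over primes \<open>l\<close> dividing \<open>m\<close> of
  \<open>1 - (\<Sum> \<omega>\<^bsup>log y\<^esup>) / (l - 1)\<close>, where \<open>\<omega>\<close> runs over the \<open>l\<close>-th roots of unity other than \<open>1\<close>: it vanishes
  if \<open>y\<close> is not \<open>m\<close>-free, and apart from the main term \<open>q\<close> each of the at most \<open>W(m) - 1\<close> terms of the
  expansion contributes at most \<open>(n - 1) \<surd>q\<close> to the sum over \<open>y = a + \<beta>\<close>.
\<close>

section \<open>Frobenius and linear algebra\<close>

lemma frobenius_diff:
  fixes x y :: "'k::comm_ring_1"
  assumes "prime CHAR('k)" "Q = CHAR('k) ^ e"
  shows "(x - y) ^ Q = x ^ Q - y ^ Q"
proof -
  have "((x - y) + y) ^ Q = (x - y) ^ Q + y ^ Q"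
    by (rule freshmans_dream'[OF assms])
  thus ?thesis by (simp add: algebra_simps)
qed

lemma frobenius_inj:
  fixes x y :: "'k::field"
  assumes "prime CHAR('k)" "Q = CHAR('k) ^ e" "x ^ Q = y ^ Q"
  shows "x = y"
proof -
  have "(x - y) ^ Q = 0"
    using frobenius_diff[OF assms(1,2), of x y] assms(3) by simp
  thus ?thesis by simp
qed

text \<open>A multiple root would also be a root of the derivative, so no linear factor
  repeats.\<close>

lemma card_roots_separable:
  fixes p :: "'k::alg_closed_field poly"
  assumes "p \<noteq> 0" and sep: "\<And>x. poly p x = 0 \<Longrightarrow> poly (pderiv p) x \<noteq> 0"
  shows "card {x. poly p x = 0} = degree p"
proof -
  obtain A where A: "size A = degree p" "p = smult (lead_coeff p) (\<Prod>x\<in>#A. [:-x, 1:])"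
    using alg_closed_imp_factorization[OF assms(1)] by blast
  have root: "poly p x = 0 \<longleftrightarrow> x \<in># A" for x
    by (subst A(2)) (auto simp: poly_prod_mset assms(1) prod_mset_zero_iff image_iff)
  have "count A x \<le> 1" for x
  proof (rule ccontr)
    assume "\<not> count A x \<le> 1"
    hence "x \<in># A" "x \<in># A - {#x#}" by (auto simp flip: count_greater_zero_iff)
    then obtain B where B: "A = add_mset x (add_mset x B)"
      by (metis insert_DiffM)
    define r where "r = smult (lead_coeff p) (\<Prod>y\<in>#B. [:-y, 1:])"
    have p: "p = [:-x, 1:] * ([:-x, 1:] * r)"
      by (subst A(2)) (simp add: B r_def)
    have "poly (pderiv p) x = 0"
      unfolding p pderiv_mult by (simp only: poly_mult poly_add) simp
    moreover have "poly p x = 0" by (simp add: p)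
    ultimately show False using sep by blast
  qed
  hence "A = mset_set (set_mset A)"
    by (intro multiset_eqI) (metis count_eq_zero_iff count_mset_set(1,3) finite_set_mset le_antisym less_one linorder_not_le)
  hence "size A = card (set_mset A)" by (metis size_mset_set)
  moreover have "{x. poly p x = 0} = set_mset A" using root by auto
  ultimately show ?thesis using A(1) by simp
qed

lemma of_nat_char_power:
  assumes "Q = CHAR('k) ^ e" "e > 0"
  shows "(of_nat Q :: 'k::semiring_1) = 0"
  using assms by (simp only: of_nat_eq_0_iff_char_dvd) simp

text \<open>The derivative of \<open>x^Q - x\<close> is the constant \<open>-1\<close>, because
  \<open>Q\<close> is zero in \<open>'k\<close>; hence all roots are simple.\<close>

lemma card_frobenius_fixed:
  assumes "prime CHAR('k)" "Q = CHAR('k) ^ e" "e > 0"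
  shows "card {x::'k::alg_closed_field. x ^ Q = x} = Q"
proof -
  have Q: "Q > 1" using assms prime_gt_1_nat[OF assms(1)] by (metis one_less_power)
  define p :: "'k poly" where "p = monom 1 Q + [:0,-1:]"
  have deg: "degree p = Q"
    unfolding p_def using Q by (subst degree_add_eq_left) (auto simp: degree_monom_eq)
  have "card {x. poly p x = 0} = degree p"
  proof (rule card_roots_separable)
    show "p \<noteq> 0" using deg Q by auto
    fix x show "poly (pderiv p) x \<noteq> 0"
      using of_nat_char_power[OF assms(2,3)]
      by (simp add: p_def pderiv_add pderiv_monom poly_monom pderiv_pCons)
  qed
  moreover have "{x. poly p x = 0} = {x. x ^ Q = x}"
    by (simp add: p_def poly_monom)
  ultimately show ?thesis using deg by simp
qed

lemma card_power_roots:
  fixes a :: "'k::alg_closed_field"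
  assumes "a \<noteq> 0" "d > 0" "(of_nat d :: 'k) \<noteq> 0"
  shows "card {y. y ^ d = a} = d"
proof -
  define p :: "'k poly" where "p = monom 1 d + [:-a:]"
  have deg: "degree p = d"
    unfolding p_def using assms by (subst degree_add_eq_left) (auto simp: degree_monom_eq)
  have "card {x. poly p x = 0} = degree p"
  proof (rule card_roots_separable)
    show "p \<noteq> 0" using deg assms by auto
    fix x assume "poly p x = 0"
    hence "x ^ d = a" by (simp add: p_def poly_monom)
    hence "x \<noteq> 0" using assms by (auto simp: zero_power)
    thus "poly (pderiv p) x \<noteq> 0"
      using assms(3) by (simp add: p_def pderiv_add pderiv_monom poly_monom pderiv_pCons)
  qed
  moreover have "{x. poly p x = 0} = {x. x ^ d = a}"
    by (simp add: p_def poly_monom)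
  ultimately show ?thesis using deg by simp
qed

text \<open>Gaussian elimination, one equation at a time: an equation with all coefficients zero is
  dropped, any other is solved for a pivot variable.\<close>

lemma homogeneous_system_nontrivial_solution:
  fixes A :: "'e \<Rightarrow> 'u \<Rightarrow> 'k::field"
  assumes "finite E" "finite U" "card E < card U"
  shows "\<exists>c. (\<exists>u\<in>U. c u \<noteq> 0) \<and> (\<forall>e\<in>E. (\<Sum>u\<in>U. A e u * c u) = 0)"
  using assms
proof (induction E arbitrary: U A rule: finite_induct)
  case empty
  hence "U \<noteq> {}" by auto
  thus ?case by (intro exI[of _ "\<lambda>_. 1"]) auto
next
  case (insert e E)
  show ?case
  proof (cases "\<forall>u\<in>U. A e u = 0")
    case True
    have "card E < card U" using insert by simp
    then obtain c where "\<exists>u\<in>U. c u \<noteq> 0" "\<forall>e\<in>E. (\<Sum>u\<in>U. A e u * c u) = 0"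
      using insert.IH[of U A] insert.prems by blast
    thus ?thesis using True by (intro exI[of _ c]) auto
  next
    case False
    then obtain v where v: "v \<in> U" "A e v \<noteq> 0" by blast
    define A' where "A' = (\<lambda>e' u. A e' u - A e' v * A e u / A e v)"
    have "card E < card (U - {v})" using insert v by simp
    then obtain c where c: "\<exists>u\<in>U - {v}. c u \<noteq> 0" "\<forall>e'\<in>E. (\<Sum>u\<in>U - {v}. A' e' u * c u) = 0"
      using insert.IH[of "U - {v}" A'] insert.prems by blast
    define s where "s = (\<Sum>u\<in>U - {v}. A e u * c u)"
    define c' where "c' = c(v := - s / A e v)"
    have split: "(\<Sum>u\<in>U. A e' u * c' u) = A e' v * c' v + (\<Sum>u\<in>U - {v}. A e' u * c u)" for e'
    proof -
      have "(\<Sum>u\<in>U - {v}. A e' u * c' u) = (\<Sum>u\<in>U - {v}. A e' u * c u)"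
        by (intro sum.cong) (auto simp: c'_def)
      thus ?thesis using insert.prems v by (simp add: sum.remove[of U v])
    qed
    have "(\<Sum>u\<in>U. A e' u * c' u) = 0" if "e' \<in> E" for e'
    proof -
      have "0 = (\<Sum>u\<in>U - {v}. A e' u * c u - (A e' v / A e v) * (A e u * c u))"
        using c(2) that by (simp add: A'_def algebra_simps)
      also have "\<dots> = (\<Sum>u\<in>U - {v}. A e' u * c u) - (A e' v / A e v) * s"
        by (simp add: s_def sum_subtractf sum_distrib_left)
      finally show ?thesis unfolding split by (simp add: c'_def)
    qed
    moreover have "(\<Sum>u\<in>U. A e u * c' u) = 0"
      unfolding split using v by (simp add: c'_def s_def)
    ultimately show ?thesis using c(1)
      by (intro exI[of _ c']) (auto simp: c'_def)
  qed
qed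

section \<open>Stepanov's method\<close>

lemma weighted_pair_unique:
  fixes i i' j j' d m :: nat
  assumes "coprime d m" "j < d" "j' < d" "d * i + m * j = d * i' + m * j'"
  shows "i = i' \<and> j = j'"
proof -
  have "[m * j = m * j'] (mod d)"
    using assms(4) by (metis cong_def mod_mult_self4)
  hence "[j = j'] (mod d)"
    using assms(1) by (simp add: cong_mult_lcancel_nat coprime_commute)
  hence "j = j'" using assms by (simp add: cong_less_modulus_unique_nat)
  thus ?thesis using assms by auto
qed

text \<open>Some \<open>j < d\<close> satisfies \<open>m * j = s\<close> modulo \<open>d\<close>,
  and \<open>m * j \<le> d * m \<le> s\<close> leaves a nonnegative multiple of
  \<open>d\<close>.\<close>

lemma weighted_pair_exists:
  fixes d m s :: nat
  assumes "coprime d m" "d > 0" "d * m \<le> s"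
  shows "\<exists>i j. j < d \<and> d * i + m * j = s"
proof -
  obtain x where x: "[m * x = 1] (mod d)"
    using cong_solve_coprime_nat[of m d] assms(1) by (auto simp: coprime_commute)
  define j where "j = (x * s) mod d"
  have "[m * j = m * (x * s)] (mod d)"
    unfolding j_def by (intro cong_scalar_left) (simp add: cong_def)
  also have "m * (x * s) = (m * x) * s" by simp
  also have "[(m * x) * s = 1 * s] (mod d)" using x by (rule cong_scalar_right)
  finally have c: "[m * j = s] (mod d)" by simp
  have j: "j < d" unfolding j_def using assms by simp
  hence "m * j \<le> s" using assms(3) by (metis le_trans less_imp_le_nat mult.commute mult_le_mono1)
  hence "d dvd s - m * j" using c
    by (metis cong_sym cong_altdef_nat)
  then obtain i where "s - m * j = d * i" by (elim dvdE)
  thus ?thesis using j \<open>m * j \<le> s\<close> by (intro exI[of _ i] exI[of _ j]) auto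
qed

text \<open>The functions \<open>x\<^sup>i y\<^sup>j\<close> with \<open>j < d\<close> on the curve \<open>y\<^sup>d = f(x)\<close>, where \<open>deg f = m\<close> is prime
  to \<open>d\<close>, have pairwise distinct pole orders \<open>d i + m j\<close> at the point at infinity.\<close>

definition pole_bounded :: "nat \<Rightarrow> nat \<Rightarrow> nat \<Rightarrow> (nat \<times> nat) set" where
  "pole_bounded d m t = {(i, j). j < d \<and> d * i + m * j \<le> t}"

lemma finite_pole_bounded:
  assumes "d > 0" shows "finite (pole_bounded d m t)"
proof (rule finite_subset)
  show "pole_bounded d m t \<subseteq> {..t} \<times> {..<d}"
  proof
    fix u assume "u \<in> pole_bounded d m t"
    then obtain i j where u: "u = (i, j)" "j < d" "d * i + m * j \<le> t"
      by (auto simp: pole_bounded_def)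
    have "1 * i \<le> d * i" using assms by (intro mult_right_mono) auto
    hence "i \<le> t" using u by linarith
    thus "u \<in> {..t} \<times> {..<d}" using u by auto
  qed
qed auto

lemma card_pole_bounded_upper:
  assumes "d > 0" "coprime d m"
  shows "card (pole_bounded d m t) \<le> t + 1"
proof -
  have "card (pole_bounded d m t) \<le> card {..t}"
  proof (rule card_inj_on_le[where f = "\<lambda>(i, j). d * i + m * j"])
    show "inj_on (\<lambda>(i, j). d * i + m * j) (pole_bounded d m t)"
    proof (rule inj_onI)
      fix u v assume *: "u \<in> pole_bounded d m t" "v \<in> pole_bounded d m t"
        "(case u of (i, j) \<Rightarrow> d * i + m * j) = (case v of (i, j) \<Rightarrow> d * i + m * j)"
      obtain i j i' j' where uv: "u = (i, j)" "v = (i', j')" by fastforce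
      show "u = v"
        using * weighted_pair_unique[OF assms(2), of j j' i i'] by (auto simp: uv pole_bounded_def)
    qed
  qed (auto simp: pole_bounded_def)
  thus ?thesis by simp
qed

text \<open>Every value from \<open>d * m\<close> to \<open>t\<close> is a pole order, so at most
  \<open>d * m\<close> values up to \<open>t\<close> are missed.\<close>

lemma card_pole_bounded_lower:
  assumes "d > 0" "coprime d m"
  shows "t + 1 \<le> card (pole_bounded d m t) + d * m"
proof -
  have "{d * m..t} \<subseteq> (\<lambda>(i, j). d * i + m * j) ` pole_bounded d m t"
  proof
    fix s assume "s \<in> {d * m..t}"
    then obtain i j where "j < d" "d * i + m * j = s" "s \<le> t"
      using weighted_pair_exists[OF assms(2,1), of s] by auto
    thus "s \<in> (\<lambda>(i, j). d * i + m * j) ` pole_bounded d m t"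
      by (intro image_eqI[of _ _ "(i, j)"]) (auto simp: pole_bounded_def)
  qed
  hence "card {d * m..t} \<le> card (pole_bounded d m t)"
    using surj_card_le[OF finite_pole_bounded[OF assms(1)]] by blast
  thus ?thesis by simp
qed

text \<open>The coefficient of \<open>y\<^sup>c\<close> when \<open>\<Sum>\<^sub>u a\<^sub>u x\<^bsup>\<alpha> u\<^esup> y\<^bsup>e u\<^esup>\<close> is reduced modulo \<open>y\<^sup>d = f(x)\<close>.\<close>

definition reduced :: "'k::field poly \<Rightarrow> nat \<Rightarrow> 'u set \<Rightarrow> ('u \<Rightarrow> 'k) \<Rightarrow> ('u \<Rightarrow> nat) \<Rightarrow> ('u \<Rightarrow> nat)
    \<Rightarrow> nat \<Rightarrow> 'k poly" where
  "reduced f d U a \<alpha> e c =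
     (\<Sum>u | u \<in> U \<and> e u mod d = c. smult (a u) (monom 1 (\<alpha> u) * f ^ (e u div d)))"

lemma eval_reduced:
  assumes "finite U" "d > 0" "y ^ d = poly f x"
  shows "(\<Sum>c<d. y ^ c * poly (reduced f d U a \<alpha> e c) x) = (\<Sum>u\<in>U. a u * x ^ \<alpha> u * y ^ e u)"
proof -
  have monomial: "y ^ c * (a u * (x ^ \<alpha> u * poly f x ^ (e u div d))) = a u * x ^ \<alpha> u * y ^ e u"
    if "e u mod d = c" for c u
  proof -
    have "y ^ e u = y ^ (d * (e u div d) + e u mod d)" by simp
    also have "\<dots> = poly f x ^ (e u div d) * y ^ c"
      unfolding power_add power_mult assms(3) that by simp
    finally show ?thesis by (simp add: algebra_simps)
  qed
  have "(\<Sum>c<d. y ^ c * poly (reduced f d U a \<alpha> e c) x)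
      = (\<Sum>c<d. \<Sum>u | u \<in> U \<and> e u mod d = c. a u * x ^ \<alpha> u * y ^ e u)"
    by (intro sum.cong refl)
       (simp add: reduced_def poly_sum sum_distrib_left poly_monom monomial)
  also have "\<dots> = (\<Sum>u\<in>U. a u * x ^ \<alpha> u * y ^ e u)"
    using assms by (subst sum.group) auto
  finally show ?thesis .
qed

text \<open>With \<open>m = degree f\<close>, the number \<open>d * s + m * c\<close> is the pole
  order of \<open>x^s y^c\<close>. Replacing \<open>y^d\<close> by \<open>f\<close> does not raise
  the pole order of a monomial.\<close>

lemma coeff_reduced_term:
  fixes f :: "'k::field poly"
  assumes "f \<noteq> 0" "d > 0"
    and "coeff (smult b (monom 1 (\<alpha>) * f ^ (e div d))) s \<noteq> 0"
  shows "d * s + degree f * (e mod d) \<le> d * \<alpha> + degree f * e" "b \<noteq> 0"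
proof -
  show "b \<noteq> 0" using assms by auto
  have "s \<le> degree (monom (1::'k) (\<alpha>) * f ^ (e div d))"
    by (rule le_degree) (use assms in auto)
  also have "\<dots> = \<alpha> + degree f * (e div d)"
    using assms by (subst degree_mult_eq) (auto simp: degree_monom_eq degree_power_eq)
  finally have "d * s \<le> d * (\<alpha> + degree f * (e div d))" by (rule mult_left_mono) simp
  also have "d * (\<alpha> + degree f * (e div d)) + degree f * (e mod d) =
     d * \<alpha> + degree f * (d * (e div d) + e mod d)" by (simp only: algebra_simps)
  finally show "d * s + degree f * (e mod d) \<le> d * \<alpha> + degree f * e"
    by simp
qed

lemma coeff_reduced_bound:
  fixes f :: "'k::field poly"
  assumes "f \<noteq> 0" "d > 0" "coeff (reduced f d U a \<alpha> e c) s \<noteq> 0"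
    and "\<And>u. u \<in> U \<Longrightarrow> a u \<noteq> 0 \<Longrightarrow> d * \<alpha> u + degree f * e u \<le> T"
  shows "d * s + degree f * c \<le> T"
proof -
  obtain u where u: "u \<in> U" "e u mod d = c"
    "coeff (smult (a u) (monom 1 (\<alpha> u) * f ^ (e u div d))) s \<noteq> 0"
    using assms(3) unfolding reduced_def coeff_sum
    by (metis (mono_tags, lifting) mem_Collect_eq sum.neutral)
  show ?thesis
    using coeff_reduced_term[OF assms(1,2) u(3)] assms(4)[OF u(1)] u(2) by auto
qed

text \<open>Pole orders being distinct, the monomial of largest pole order among those with nonzero
  coefficient has a leading term that no other monomial can cancel.\<close>

lemma reduced_nonzero:
  fixes f :: "'k::field poly"
  assumes "f \<noteq> 0" "d > 0" "finite U" "\<exists>u\<in>U. a u \<noteq> 0"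
    and inj: "inj_on (\<lambda>u. d * \<alpha> u + degree f * e u) U"
  shows "\<exists>c<d. reduced f d U a \<alpha> e c \<noteq> 0"
proof -
  define w where "w = (\<lambda>u. d * \<alpha> u + degree f * e u)"
  define V where "V = {u \<in> U. a u \<noteq> 0}"
  have V: "finite V" "V \<noteq> {}" using assms by (auto simp: V_def)
  obtain v where v: "v \<in> V" "\<And>u. u \<in> V \<Longrightarrow> w u \<le> w v"
  proof -
    have "Max (w ` V) \<in> w ` V" using V by simp
    then obtain v where "v \<in> V" "w v = Max (w ` V)" by auto
    thus ?thesis using that[of v] V by simp
  qed
  define c where "c = e v mod d"
  define s where "s = \<alpha> v + degree f * (e v div d)"
  have ws: "d * s + degree f * c = w v"
  proof -
    have "d * s + degree f * c = d * \<alpha> v + degree f * (d * (e v div d) + e v mod d)"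
      unfolding s_def c_def by (simp only: algebra_simps)
    thus ?thesis by (simp add: w_def)
  qed
  have other: "coeff (smult (a u) (monom 1 (\<alpha> u) * f ^ (e u div d))) s = 0"
    if "u \<in> U" "e u mod d = c" "u \<noteq> v" for u
  proof (rule ccontr)
    assume *: "coeff (smult (a u) (monom 1 (\<alpha> u) * f ^ (e u div d))) s \<noteq> 0"
    have "d * s + degree f * c \<le> w u" "a u \<noteq> 0"
      using coeff_reduced_term[OF assms(1,2) *] that(2) by (auto simp: w_def)
    hence "w u = w v" using v(2)[of u] that(1) ws by (auto simp: V_def)
    hence "u = v" using inj that(1) v(1) by (auto simp: V_def inj_on_def w_def)
    thus False using that by simp
  qed
  have "coeff (reduced f d U a \<alpha> e c) s
      = (\<Sum>u\<in>{v}. coeff (smult (a u) (monom 1 (\<alpha> u) * f ^ (e u div d))) s)"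
    unfolding reduced_def coeff_sum
    by (rule sum.mono_neutral_right) (use other v(1) assms(3) in \<open>auto simp: c_def V_def\<close>)
  also have "\<dots> = a v * lead_coeff (monom 1 (\<alpha> v) * f ^ (e v div d))"
  proof -
    have "degree (monom 1 (\<alpha> v) * f ^ (e v div d)) = s"
      using assms by (subst degree_mult_eq) (auto simp: degree_monom_eq degree_power_eq s_def)
    thus ?thesis by simp
  qed
  also have "\<dots> \<noteq> 0" using v(1) assms(1) by (simp add: V_def)
  finally show ?thesis using assms(2) by (intro exI[of _ c]) (auto simp: c_def)
qed

text \<open>A nonzero function \<open>H\<close> of pole order at most \<open>T'\<close> is built
  that vanishes at all \<open>d\<close> points of the curve above each \<open>x\<close> in
  \<open>Z\<close>. Some nonzero coefficient polynomial of \<open>H\<close> then has all of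
  \<open>Z\<close> among its roots, while its degree is at most \<open>T' / d\<close>.\<close>

theorem stepanov_bound:
  fixes f :: "'k::alg_closed_field poly" and \<zeta> :: 'k
  assumes char: "prime CHAR('k)" and R: "R = CHAR('k) ^ e" and Q: "Q = R ^ 2"
    and d: "d > 0" "d dvd Q - 1" and coprime: "coprime d (degree f)" and \<zeta>: "\<zeta> \<noteq> 0" and f: "f \<noteq> 0"
    and g: "g = d * degree f" and R_large: "R > g ^ 2 + 3 * g + 1"
  shows "d * card {x. x ^ Q = x \<and> poly f x ^ ((Q - 1) div d) = \<zeta>} \<le> Q + (2 * g + 1) * R"
proof -
  define m where "m = degree f"
  define Z where "Z = {x. x ^ Q = x \<and> poly f x ^ ((Q - 1) div d) = \<zeta>}"
  define S where "S = pole_bounded d m"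
  \<comment> \<open>\<open>U\<close> indexes products \<open>h * h'^R\<close> of monomials, of pole
    orders at most \<open>R - 1\<close> and \<open>R + 2 * g\<close>. The first bound keeps the
    total pole orders distinct, as expansions in base \<open>R\<close>; the slack
    \<open>2 * g\<close> in the second supplies enough unknowns.\<close>
  define U where "U = S (R - 1) \<times> S (R + 2 * g)"
  \<comment> \<open>\<open>T'\<close> bounds the pole order of \<open>H\<close>, and
    \<open>T\<close> that of its \<open>R\<close>-th power rewritten with the relations valid over
    \<open>Z\<close>.\<close>
  define T where "T = (R - 1) * R + (R + 2 * g)"
  define T' where "T' = (R - 1) + (R + 2 * g) * R"
  have fin: "finite (S t)" for t using d by (simp add: S_def finite_pole_bounded)
  have finU: "finite U" by (simp add: U_def fin)
  have R1: "R > 1" using R_large by linarith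
  have Q1: "Q > 1" using R1 unfolding Q by (metis one_less_power pos2)
  have sumR: "(sum h A) ^ R = (\<Sum>u\<in>A. h u ^ R)" for h :: "(nat \<times> nat) \<times> (nat \<times> nat) \<Rightarrow> 'k" and A
    by (rule freshmans_dream_sum'[OF char R])
  define i where "i = (\<lambda>u::(nat \<times> nat) \<times> (nat \<times> nat). fst (fst u))"
  define j where "j = (\<lambda>u::(nat \<times> nat) \<times> (nat \<times> nat). snd (fst u))"
  define i' where "i' = (\<lambda>u::(nat \<times> nat) \<times> (nat \<times> nat). fst (snd u))"
  define j' where "j' = (\<lambda>u::(nat \<times> nat) \<times> (nat \<times> nat). snd (snd u))"
  have mem_U: "j u < d" "j' u < d" "d * i u + m * j u \<le> R - 1" "d * i' u + m * j' u \<le> R + 2 * g"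
    if "u \<in> U" for u
    using that by (auto simp: U_def S_def pole_bounded_def i_def j_def i'_def j'_def)
  have weight: "d * (i u * R + i' u) + m * (j u * R + j' u) \<le> T" if "u \<in> U" for u
  proof -
    have "(d * i u + m * j u) * R + (d * i' u + m * j' u) \<le> (R - 1) * R + (R + 2 * g)"
      by (intro add_mono mult_right_mono mem_U[OF that]) auto
    thus ?thesis by (simp add: T_def algebra_simps)
  qed
  have weight': "d * (i u + i' u * R) + m * (j u + j' u * R) \<le> T'" if "u \<in> U" for u
  proof -
    have "(d * i u + m * j u) + (d * i' u + m * j' u) * R \<le> (R - 1) + (R + 2 * g) * R"
      by (intro add_mono mult_right_mono mem_U[OF that]) auto
    thus ?thesis by (simp add: T'_def algebra_simps)
  qed

  have "card (S T) < card U"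
  proof -
    have "R - 1 + 1 \<le> card (S (R - 1)) + g" "R + 2 * g + 1 \<le> card (S (R + 2 * g)) + g"
      unfolding S_def g m_def by (intro card_pole_bounded_lower d coprime)+
    hence "R - g \<le> card (S (R - 1))" "R + g + 1 \<le> card (S (R + 2 * g))"
      using R1 by linarith+
    hence "(R - g) * (R + g + 1) \<le> card U"
      unfolding U_def card_cartesian_product by (rule mult_le_mono)
    \<comment> \<open>The left side is \<open>R^2 + 2*g + 1\<close> and the right side
      \<open>R^2 + R - g^2 - g\<close>, so this is exactly the assumption
      \<open>R_large\<close>.\<close>
    moreover have "T + 1 < (R - g) * (R + g + 1)"
    proof -
      have "g ^ 2 + 3 * g + 2 \<le> R" using R_large by linarith
      then obtain k where k: "R = g ^ 2 + 3 * g + 2 + k"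
        using le_Suc_ex by blast
      show ?thesis
        unfolding T_def k by (simp add: algebra_simps power2_eq_square)
    qed
    moreover have "card (S T) \<le> T + 1"
      unfolding S_def m_def by (rule card_pole_bounded_upper[OF d(1) coprime])
    ultimately show ?thesis by linarith
  qed
  \<comment> \<open>On \<open>Z\<close> one has \<open>x\<^bsup>Q\<^esup> = x\<close> and \<open>y\<^bsup>Q\<^esup> = \<zeta> y\<close>, so the \<open>R\<close>-th power of
    \<open>\<Sum> b\<^sub>u x\<^bsup>i + i'R\<^esup> y\<^bsup>j + j'R\<^esup>\<close> becomes the left-hand side of the system below, with \<open>a\<^sub>u = b\<^sub>u\<^bsup>R\<^esup>\<close>.\<close>
  define M where "M = (\<lambda>(s, c) u. if (j u * R + j' u) mod d = c
     then coeff (smult (\<zeta> ^ j' u) (monom 1 (i u * R + i' u) * f ^ ((j u * R + j' u) div d))) s else 0)"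
  obtain a where a: "\<exists>u\<in>U. a u \<noteq> 0" "\<And>sc. sc \<in> S T \<Longrightarrow> (\<Sum>u\<in>U. M sc u * a u) = 0"
    using homogeneous_system_nontrivial_solution[OF fin finU \<open>card (S T) < card U\<close>, of M] by blast
  \<comment> \<open>The linear system determines the \<open>R\<close>-th powers \<open>a u\<close>;
    the coefficients of \<open>H\<close> are \<open>R\<close>-th roots of them.\<close>
  define b where "b = (\<lambda>u. SOME y. y ^ R = a u)"
  have b: "b u ^ R = a u" for u
    unfolding b_def by (rule someI_ex) (rule nth_root_exists, use R1 in simp)
  define P where "P = reduced f d U (\<lambda>u. \<zeta> ^ j' u * a u) (\<lambda>u. i u * R + i' u) (\<lambda>u. j u * R + j' u)"
  define H where "H = reduced f d U b (\<lambda>u. i u + i' u * R) (\<lambda>u. j u + j' u * R)"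
  have P0: "P c = 0" if "c < d" for c
  proof (rule poly_eqI)
    fix s
    show "coeff (P c) s = coeff 0 s"
    \<comment> \<open>Coefficients of pole order at most \<open>T\<close> vanish by the linear
      system; none of larger pole order occur.\<close>
    proof (cases "(s, c) \<in> S T")
      case True
      have "coeff (P c) s = (\<Sum>u\<in>U. M (s, c) u * a u)"
        unfolding P_def reduced_def coeff_sum
      proof (subst sum.inter_filter[OF finU], rule sum.cong)
        fix u
        show "(if (j u * R + j' u) mod d = c then coeff (smult (\<zeta> ^ j' u * a u)
            (monom 1 (i u * R + i' u) * f ^ ((j u * R + j' u) div d))) s else 0) = M (s, c) u * a u"
          unfolding M_def prod.case
          by (cases "(j u * R + j' u) mod d = c")
             (simp_all only: coeff_smult simp_thms if_True if_False mult_zero_left mult.assoc mult.commute[of "a u"])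
      qed simp
      also have "\<dots> = 0" by (rule a(2)[OF True])
      finally show ?thesis by (simp only: coeff_0)
    next
      case False
      show ?thesis
      proof (rule ccontr)
        assume "coeff (P c) s \<noteq> coeff 0 s"
        hence nz: "coeff (P c) s \<noteq> 0" by simp
        have "d * s + m * c \<le> T"
          unfolding m_def
          by (rule coeff_reduced_bound[OF f d(1) nz[unfolded P_def]]) (rule weight[unfolded m_def])
        thus False using False that by (simp add: S_def pole_bounded_def)
      qed
    qed
  qed
  have H_vanish: "poly (H c) x = 0" if x: "x \<in> Z" and c: "c < d" for x c
  proof -
    have x1: "x ^ Q = x" "poly f x ^ ((Q - 1) div d) = \<zeta>" using x by (auto simp: Z_def)
    have Qd: "d * ((Q - 1) div d) + 1 = Q" using d Q1 by simp
    hence "(Q - 1) div d > 0" using Q1 by (intro Nat.gr0I) auto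
    hence fx: "poly f x \<noteq> 0" using x1 \<zeta> by (auto simp: zero_power)
    \<comment> \<open>As a divisor of \<open>Q - 1\<close>, \<open>d\<close> is prime to the
      characteristic, so \<open>y^d = poly f x\<close> has \<open>d\<close> distinct
      solutions.\<close>
    have "of_nat d \<noteq> (0::'k)"
    proof
      assume "of_nat d = (0::'k)"
      hence "CHAR('k) dvd d" by (simp add: of_nat_eq_0_iff_char_dvd)
      hence "CHAR('k) dvd Q - 1" using d by (meson dvd_trans)
      moreover have "e > 0" using R1 R by (intro Nat.gr0I) simp
      hence "CHAR('k) dvd R" unfolding R by simp
      hence "CHAR('k) dvd Q" unfolding Q by (simp add: power2_eq_square)
      ultimately have "CHAR('k) dvd 1" using Q1
        by (metis dvd_diffD1 less_imp_le_nat)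
      thus False using char by (metis not_prime_unit)
    qed
    hence card_Y: "card {y. y ^ d = poly f x} = d"
      using card_power_roots[OF fx d(1)] by simp
    \<comment> \<open>For fixed \<open>x\<close>, \<open>H\<close> is a polynomial in
      \<open>y\<close> of degree below \<open>d\<close>. It has \<open>d\<close> distinct roots, so
      all its coefficients vanish.\<close>
    define \<Psi> where "\<Psi> = (\<Sum>c<d. monom (poly (H c) x) c)"
    have "poly \<Psi> y = 0" if y: "y ^ d = poly f x" for y
    proof -
      have yQ: "y ^ Q = \<zeta> * y"
      proof -
        have "y ^ Q = y ^ (d * ((Q - 1) div d) + 1)" using Qd by simp
        also have "\<dots> = \<zeta> * y" unfolding power_add power_mult y x1 by simp
        finally show ?thesis .
      qed
      have xRR: "(x ^ R) ^ R = x" using x1(1) by (simp add: Q power2_eq_square power_mult)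
      have yRR: "(y ^ R) ^ R = \<zeta> * y" using yQ by (simp add: Q power2_eq_square power_mult)
      have *: "(b u * x ^ (i u + i' u * R) * y ^ (j u + j' u * R)) ^ R =
         (\<zeta> ^ j' u * a u) * x ^ (i u * R + i' u) * y ^ (j u * R + j' u)" for u
      proof -
        have "(x ^ (i u + i' u * R)) ^ R = x ^ (i u * R) * ((x ^ R) ^ R) ^ i' u"
          by (simp add: power_add power_mult_distrib mult_ac flip: power_mult)
        moreover have "(y ^ (j u + j' u * R)) ^ R = y ^ (j u * R) * ((y ^ R) ^ R) ^ j' u"
          by (simp add: power_add power_mult_distrib mult_ac flip: power_mult)
        ultimately have "(b u * x ^ (i u + i' u * R) * y ^ (j u + j' u * R)) ^ R
            = a u * (x ^ (i u * R) * x ^ i' u) * (y ^ (j u * R) * (\<zeta> * y) ^ j' u)"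
          by (simp only: power_mult_distrib[of "_ * _"] power_mult_distrib[of "b u"] b xRR yRR)
        thus ?thesis by (simp only: power_add power_mult_distrib mult_ac)
      qed
      have "poly \<Psi> y = (\<Sum>c<d. y ^ c * poly (H c) x)"
        by (simp add: \<Psi>_def poly_sum poly_monom mult.commute)
      also have "\<dots> = (\<Sum>u\<in>U. b u * x ^ (i u + i' u * R) * y ^ (j u + j' u * R))"
        unfolding H_def by (rule eval_reduced[OF finU d(1) y])
      finally have "poly \<Psi> y ^ R = (\<Sum>u\<in>U. (\<zeta> ^ j' u * a u) * x ^ (i u * R + i' u) * y ^ (j u * R + j' u))"
        by (simp add: sumR *)
      also have "\<dots> = (\<Sum>c<d. y ^ c * poly (P c) x)"
        unfolding P_def by (rule eval_reduced[OF finU d(1) y, symmetric])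
      also have "\<dots> = 0" by (simp add: P0)
      finally show ?thesis by simp
    qed
    have "\<Psi> = 0"
    proof (rule ccontr)
      assume "\<Psi> \<noteq> 0"
      have "d = card {y. y ^ d = poly f x}" using card_Y by simp
      also have "\<dots> \<le> card {y. poly \<Psi> y = 0}"
        using \<open>\<Psi> \<noteq> 0\<close> \<open>\<And>y. y ^ d = poly f x \<Longrightarrow> poly \<Psi> y = 0\<close>
        by (intro card_mono poly_roots_finite) auto
      also have "\<dots> \<le> degree \<Psi>" by (rule card_poly_roots_bound[OF \<open>\<Psi> \<noteq> 0\<close>])
      also have "\<dots> < d" unfolding \<Psi>_def
      proof (rule degree_sum_less)
        show "degree (monom (poly (H c) x) c) < d" if "c \<in> {..<d}" for c
          using that degree_monom_le le_less_trans by blast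
      qed (use d in auto)
      finally show False by simp
    qed
    hence "coeff \<Psi> c = 0" by simp
    thus ?thesis using c by (simp add: \<Psi>_def coeff_sum coeff_monom if_distrib cong: if_cong)
  qed
  have "\<exists>c<d. H c \<noteq> 0"
    unfolding H_def
  proof (rule reduced_nonzero[OF f d(1) finU])
    show "\<exists>u\<in>U. b u \<noteq> 0" using a(1) b R1 by (metis power_0_left not_one_less_zero)
    show "inj_on (\<lambda>u. d * (i u + i' u * R) + degree f * (j u + j' u * R)) U"
    proof (rule inj_onI)
      fix u v assume uv: "u \<in> U" "v \<in> U" "d * (i u + i' u * R) + degree f * (j u + j' u * R)
         = d * (i v + i' v * R) + degree f * (j v + j' v * R)"
      define w where "w = (\<lambda>u. d * i u + m * j u)"
      define w' where "w' = (\<lambda>u. d * i' u + m * j' u)"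
      have eq: "w u + w' u * R = w v + w' v * R"
        using uv(3) by (simp add: w_def w'_def m_def algebra_simps)
      \<comment> \<open>As \<open>w u < R\<close>, both \<open>w u\<close> and \<open>w' u\<close>
        are recovered as remainder and quotient modulo \<open>R\<close>; each then determines its
        pair of exponents.\<close>
      have less: "w u < R" "w v < R" using mem_U(3)[OF uv(1)] mem_U(3)[OF uv(2)] R1
        by (auto simp: w_def)
      have "w u = (w u + w' u * R) mod R" using less by simp
      also have "\<dots> = w v" unfolding eq using less by simp
      finally have "w u = w v" .
      moreover from this have "w' u = w' v" using eq R1 by simp
      ultimately have "i u = i v \<and> j u = j v" "i' u = i' v \<and> j' u = j' v"
        using weighted_pair_unique[of d m "j u" "j v" "i u" "i v"]
          weighted_pair_unique[of d m "j' u" "j' v" "i' u" "i' v"] mem_U[OF uv(1)] mem_U[OF uv(2)] coprime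
        by (auto simp: w_def w'_def m_def)
      thus "u = v" by (auto simp: i_def j_def i'_def j'_def prod_eq_iff)
    qed
  qed
  then obtain c where c: "c < d" "H c \<noteq> 0" by blast
  have "card Z \<le> card {x. poly (H c) x = 0}"
    using H_vanish c by (intro card_mono poly_roots_finite) auto
  also have "\<dots> \<le> degree (H c)" by (rule card_poly_roots_bound[OF c(2)])
  finally have "d * card Z \<le> d * degree (H c)" by simp
  also have "d * degree (H c) + m * c \<le> T'"
  proof -
    have nz: "coeff (H c) (degree (H c)) \<noteq> 0" using c by simp
    show ?thesis
      unfolding m_def
      by (rule coeff_reduced_bound[OF f d(1) nz[unfolded H_def], folded H_def]) (rule weight'[unfolded m_def])
  qed
  hence "d * degree (H c) \<le> T'" by simp
  also have "T' \<le> Q + (2 * g + 1) * R"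
    unfolding T'_def Q by (simp add: algebra_simps power2_eq_square)
  finally show ?thesis by (simp add: Z_def)
qed

section \<open>Character sums over extension fields\<close>

lemma prod_lessThan_blocks:
  fixes h :: "nat \<Rightarrow> 'c::comm_monoid_mult"
  shows "(\<Prod>i<n * k. h i) = (\<Prod>j<k. \<Prod>i<n. h (n * j + i))"
proof -
  have add: "(\<Prod>i<a + b. h i) = (\<Prod>i<a. h i) * (\<Prod>i<b. h (a + i))" for a b
    by (induction b) (simp_all add: mult.assoc)
  show ?thesis
    by (induction k) (simp_all add: add add.commute[of n])
qed

lemma geometric_sum_nat: "(x - 1) * (\<Sum>i<m. x ^ i) = x ^ m - (1::nat)" if "x > 0" for x m
proof -
  have "int ((x - 1) * (\<Sum>i<m. x ^ i)) = (int x - 1) * (\<Sum>i<m. int x ^ i)"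
    using that by (simp add: of_nat_diff)
  also have "\<dots> = int x ^ m - 1" by (rule power_diff_1_eq[symmetric])
  also have "\<dots> = int (x ^ m - 1)" using that by (simp add: of_nat_diff)
  finally show ?thesis by (simp only: of_nat_eq_iff)
qed

section \<open>Finite subfields of an algebraically closed field\<close>

locale finite_subfields =
  fixes q :: nat and F :: "nat \<Rightarrow> 'k::alg_closed_field set"
  assumes F_def: "F j = {x. x ^ (q ^ j) = x}"
    and char: "prime CHAR('k)"
    and q_char: "\<exists>e>0. q = CHAR('k) ^ e"
begin

lemma F_iff: "x \<in> F j \<longleftrightarrow> x ^ (q ^ j) = x"
  by (simp add: F_def)

lemma q_power_char: "\<exists>e. q ^ j = CHAR('k) ^ e"
  using q_char by (metis power_mult)

lemma q_gt_1: "q > 1"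
  using q_char prime_gt_1_nat[OF char] by (metis one_less_power)

lemma frob_add: "(x + y :: 'k) ^ (q ^ j) = x ^ (q ^ j) + y ^ (q ^ j)"
  using q_power_char[of j] freshmans_dream'[OF char] by metis

lemma frob_diff: "(x - y :: 'k) ^ (q ^ j) = x ^ (q ^ j) - y ^ (q ^ j)"
  using q_power_char[of j] frobenius_diff[OF char] by metis

lemma frob_uminus: "(- x :: 'k) ^ (q ^ j) = - (x ^ (q ^ j))"
  using frob_diff[of 0 x j] q_gt_1 by (simp add: zero_power)

lemma frob_sum: "(\<Sum>a\<in>A. h a :: 'k) ^ (q ^ j) = (\<Sum>a\<in>A. h a ^ (q ^ j))"
  using q_power_char[of j] freshmans_dream_sum'[OF char] by metis

lemma frob_prod: "(\<Prod>a\<in>A. h a :: 'k) ^ (q ^ j) = (\<Prod>a\<in>A. h a ^ (q ^ j))"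
  by (simp add: prod_power_distrib)

lemma frob_inj: "(x :: 'k) ^ (q ^ j) = y ^ (q ^ j) \<Longrightarrow> x = y"
  using q_power_char[of j] frobenius_inj[OF char] by metis

lemma frob_frob: "((x :: 'k) ^ (q ^ i)) ^ (q ^ j) = x ^ (q ^ (i + j))"
  by (simp add: power_add flip: power_mult)

lemma frob_period: "(x :: 'k) ^ (q ^ d) = x \<Longrightarrow> x ^ (q ^ (d * k)) = x"
  by (induction k) (auto simp: frob_frob simp flip: frob_frob)

lemma F_mono_dvd: "d dvd j \<Longrightarrow> F d \<subseteq> F j"
  by (auto simp: F_iff dvd_def frob_period)

lemma F_0 [simp]: "0 \<in> F j" and F_1 [simp]: "1 \<in> F j"
  using q_gt_1 by (auto simp: F_iff zero_power)

lemma F_add: "x \<in> F j \<Longrightarrow> y \<in> F j \<Longrightarrow> x + y \<in> F j"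
  and F_diff: "x \<in> F j \<Longrightarrow> y \<in> F j \<Longrightarrow> x - y \<in> F j"
  and F_uminus: "x \<in> F j \<Longrightarrow> - x \<in> F j"
  and F_mult: "x \<in> F j \<Longrightarrow> y \<in> F j \<Longrightarrow> x * y \<in> F j"
  and F_divide: "x \<in> F j \<Longrightarrow> y \<in> F j \<Longrightarrow> x / y \<in> F j"
  and F_power: "x \<in> F j \<Longrightarrow> x ^ k \<in> F j"
  by (simp_all add: F_iff frob_add frob_diff frob_uminus power_mult_distrib power_divide)
     (metis power_commutes power_mult mult.commute)

lemma F_prod: "(\<And>a. a \<in> A \<Longrightarrow> h a \<in> F j) \<Longrightarrow> (\<Prod>a\<in>A. h a) \<in> F j"
  by (simp add: F_iff frob_prod)

text \<open>For \<open>j = 0\<close> the defining equation of \<open>F j\<close> holds everywhere,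
  so \<open>F 0\<close> is the whole infinite field; hence \<open>j > 0\<close>.\<close>

lemma card_F:
  assumes "j > 0" shows "card (F j) = q ^ j"
proof -
  obtain e where e: "e > 0" "q = CHAR('k) ^ e" using q_char by blast
  have "q ^ j = CHAR('k) ^ (e * j)" by (simp add: e power_mult)
  from card_frobenius_fixed[OF char this] show ?thesis using e assms by (simp add: F_def)
qed

lemma finite_F:
  assumes "j > 0" shows "finite (F j)"
proof (rule ccontr)
  assume "infinite (F j)"
  thus False using card_F[OF assms] q_gt_1 by simp
qed

lemma power_F:
  assumes "y \<in> F j" "y \<noteq> 0" shows "y ^ (q ^ j - 1) = 1"
proof -
  have "y ^ (q ^ j - 1) * y = y ^ (q ^ j)"
    using q_gt_1 by (metis Suc_diff_1 power_Suc2 zero_less_power gr_implies_not0 gr0I)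
  thus ?thesis using assms by (simp add: F_iff)
qed

text \<open>For positive \<open>n\<close> and \<open>k\<close>, raising to the power
  \<open>E = (q^(n*k) - 1) / (q^n - 1)\<close> is the norm from \<open>F (n * k)\<close> to
  \<open>F n\<close>.\<close>

lemma power_F_in_subfield:
  assumes "y \<in> F (n * k)" and E: "E * (q ^ n - 1) = q ^ (n * k) - 1"
  shows "y ^ E \<in> F n"
proof (cases "y = 0 \<or> E = 0")
  case True thus ?thesis by (cases "E = 0") (auto simp: zero_power)
next
  case False
  have "(y ^ E) ^ (q ^ n) = (y ^ E) ^ ((q ^ n - 1) + 1)" using q_gt_1 by simp
  also have "\<dots> = y ^ (E * (q ^ n - 1)) * y ^ E" by (simp only: power_add power_mult power_one_right)
  also have "y ^ (E * (q ^ n - 1)) = 1" unfolding E using power_F[OF assms(1)] False by simp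
  finally show ?thesis by (simp add: F_iff)
qed

end

text \<open>\<open>\<theta>\<close> generates the field of \<open>q^n\<close> elements over that of
  \<open>q\<close> elements. \<open>\<psi>\<close> is a nontrivial multiplicative character of
  \<open>F n\<close> extended by \<open>0\<close>; nontriviality is expressed by
  \<open>\<psi>_sum\<close>.\<close>

locale subfield_character = finite_subfields q F for q :: nat and F :: "nat \<Rightarrow> 'k::alg_closed_field set" +
  fixes n :: nat and \<theta> :: 'k and \<psi> :: "'k \<Rightarrow> complex"
  assumes n_pos: "n > 0"
    and \<theta>_in: "\<theta> \<in> F n"
    and \<theta>_proper: "\<And>d. 0 < d \<Longrightarrow> d < n \<Longrightarrow> \<theta> \<notin> F d"
    and \<psi>_mult: "\<And>x y. x \<in> F n \<Longrightarrow> y \<in> F n \<Longrightarrow> \<psi> (x * y) = \<psi> x * \<psi> y"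
    and \<psi>_0: "\<psi> 0 = 0" and \<psi>_1: "\<psi> 1 = 1"
    and \<psi>_le: "\<And>x. x \<in> F n \<Longrightarrow> norm (\<psi> x) \<le> 1"
    and \<psi>_sum: "(\<Sum>x\<in>F n. \<psi> x) = 0"
begin

text \<open>For \<open>r > 0\<close> the product is the value at \<open>\<theta>\<close> of the
  characteristic polynomial of \<open>x\<close> over the field of \<open>q\<close> elements, so it
  lies in \<open>F n\<close>.\<close>

definition S :: "nat \<Rightarrow> complex" where
  "S r = (\<Sum>x\<in>F r. \<psi> (\<Prod>i<r. \<theta> - x ^ (q ^ i)))"

lemma \<theta>_frob: "\<theta> ^ (q ^ n) = \<theta>"
  using \<theta>_in by (simp add: F_iff)

text \<open>Because \<open>\<psi>\<close> sums to zero, each fibre size \<open>N z\<close> may be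
  replaced by \<open>N z - B\<close>. These differences are never positive, so the sum of their
  absolute values follows from the total number of points; this is why upper bounds on the fibres
  suffice.\<close>

lemma sum_fibres_bound:
  assumes "finite T" "\<And>t. t \<in> T \<Longrightarrow> h t \<in> F n"
    and fibre: "\<And>z. z \<in> F n - {0} \<Longrightarrow> real (card {t\<in>T. h t = z}) \<le> B"
  shows "norm (\<Sum>t\<in>T. \<psi> (h t)) \<le> real (q ^ n - 1) * B - real (card {t\<in>T. h t \<noteq> 0})"
proof -
  define N where "N = (\<lambda>z. real (card {t\<in>T. h t = z}))"
  have fin: "finite (F n)" by (rule finite_F[OF n_pos])
  have "(\<Sum>t\<in>T. \<psi> (h t)) = (\<Sum>z\<in>F n. \<Sum>t | t \<in> T \<and> h t = z. \<psi> (h t))"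
    using assms by (intro sum.group[symmetric] fin) auto
  also have "\<dots> = (\<Sum>z\<in>F n. N z * \<psi> z)"
    by (intro sum.cong) (auto simp: N_def)
  also have "\<dots> = (\<Sum>z\<in>F n - {0}. N z * \<psi> z)"
    using fin by (subst sum.remove[of _ 0]) (auto simp: \<psi>_0)
  also have "\<dots> = - (\<Sum>z\<in>F n - {0}. of_real (B - N z) * \<psi> z)"
  proof -
    have "(\<Sum>z\<in>F n - {0}. \<psi> z) = 0"
      using \<psi>_sum fin by (subst (asm) sum.remove[of _ 0]) (auto simp: \<psi>_0)
    hence "(\<Sum>z\<in>F n - {0}. of_real B * \<psi> z) = 0"
      by (simp flip: sum_distrib_left)
    thus ?thesis by (simp add: left_diff_distrib sum_subtractf)
  qed
  finally have "norm (\<Sum>t\<in>T. \<psi> (h t)) \<le> (\<Sum>z\<in>F n - {0}. norm (of_real (B - N z) * \<psi> z))"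
    by (simp only: norm_minus_cancel norm_sum)
  also have "\<dots> \<le> (\<Sum>z\<in>F n - {0}. B - N z)"
  proof (rule sum_mono)
    fix z assume z: "z \<in> F n - {0}"
    have "\<bar>B - N z\<bar> * norm (\<psi> z) \<le> \<bar>B - N z\<bar> * 1"
      using \<psi>_le z by (intro mult_left_mono) auto
    moreover have "N z \<le> B" using fibre[OF z] by (simp add: N_def)
    ultimately show "norm (of_real (B - N z) * \<psi> z) \<le> B - N z"
 using abs_of_nonneg[of "B - N z"] mult_1_right[of "B - N z"] by (simp only: norm_mult norm_of_real)
  qed
  also have "\<dots> = real (q ^ n - 1) * B - (\<Sum>z\<in>F n - {0}. N z)"
    using fin card_F[OF n_pos] by (simp add: sum_subtractf)
  also have "(\<Sum>z\<in>F n - {0}. N z) = real (card {t\<in>T. h t \<noteq> 0})"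
  proof -
    have "{t\<in>T. h t \<noteq> 0} = (\<Union>z\<in>F n - {0}. {t\<in>T. h t = z})" using assms by auto
    hence "card {t\<in>T. h t \<noteq> 0} = (\<Sum>z\<in>F n - {0}. card {t\<in>T. h t = z})"
      using assms(1) fin by (simp only:) (rule card_UN_disjoint, auto)
    thus ?thesis by (simp add: N_def)
  qed
  finally show ?thesis .
qed

text \<open>With \<open>x = \<theta> - 1/t\<close> the norm of \<open>\<theta> - x\<close> becomes a power of \<open>f(t)\<close> for a polynomial \<open>f\<close>
  whose degree is prime to \<open>q\<^sup>n - 1\<close>; the exponent of \<open>t\<close> is adjusted for this purpose.\<close>

definition twist_poly :: "'k poly" where
  "twist_poly = monom 1 ((q ^ n - 1) - (\<Sum>i<n. q ^ i))
     * (\<Prod>i\<in>{1..<n}. [:1, \<theta> ^ (q ^ (n - i)) - \<theta>:] ^ (q ^ i))"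

lemma sum_powers_le: "(\<Sum>i<n. q ^ i) \<le> q ^ n - 1"
proof -
  have "1 * (\<Sum>i<n. q ^ i) \<le> (q - 1) * (\<Sum>i<n. q ^ i)"
    using q_gt_1 by (intro mult_right_mono) auto
  also have "\<dots> = q ^ n - 1" by (rule geometric_sum_nat) (use q_gt_1 in simp)
  finally show ?thesis by simp
qed

lemma conjugate_neq: "0 < i \<Longrightarrow> i < n \<Longrightarrow> \<theta> ^ (q ^ i) \<noteq> \<theta>"
  using \<theta>_proper[of i] by (simp add: F_iff)

lemma twist_poly_nonzero: "twist_poly \<noteq> 0"
  by (auto simp: twist_poly_def)

text \<open>\<open>q^n - 2\<close> is prime to \<open>q^n - 1\<close>, as Stepanov's bound demands.
  The linear factors are nonconstant because \<open>\<theta>\<close> differs from its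
  conjugates.\<close>

lemma degree_twist_poly: "degree twist_poly = q ^ n - 2"
proof -
  have lin: "degree ([:1, \<theta> ^ (q ^ (n - i)) - \<theta>:] ^ (q ^ i)) = q ^ i" if "i \<in> {1..<n}" for i
  proof -
    have "\<theta> ^ (q ^ (n - i)) - \<theta> \<noteq> 0" using conjugate_neq[of "n - i"] that by simp
    thus ?thesis by (simp add: degree_power_eq)
  qed
  have "degree (\<Prod>i\<in>{1..<n}. [:1, \<theta> ^ (q ^ (n - i)) - \<theta>:] ^ (q ^ i)) = (\<Sum>i\<in>{1..<n}. q ^ i)"
    by (subst degree_prod_eq_sum_degree) (simp, rule sum.cong[OF refl lin])
  hence "degree twist_poly = (q ^ n - 1) - (\<Sum>i<n. q ^ i) + (\<Sum>i\<in>{1..<n}. q ^ i)"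
    unfolding twist_poly_def by (subst degree_mult_eq) (auto simp: degree_monom_eq)
  moreover have "(\<Sum>i<n. q ^ i) = 1 + (\<Sum>i\<in>{1..<n}. q ^ i)"
    using n_pos by (simp add: lessThan_atLeast0 sum.atLeast_Suc_lessThan)
  ultimately show ?thesis using sum_powers_le by simp
qed

lemma poly_twist_poly_in:
  assumes "n dvd r" "t \<in> F r" shows "poly twist_poly t \<in> F r"
proof -
  have "\<theta> \<in> F r" using F_mono_dvd[OF assms(1)] \<theta>_in by blast
  thus ?thesis using assms
    by (auto simp: twist_poly_def poly_monom poly_prod intro!: F_mult F_prod F_power F_add F_diff)
qed

lemma norm_eq_twist_poly:
  assumes t: "t \<in> F (n * k)" "t \<noteq> 0" and E: "E = (\<Sum>j<k. (q ^ n) ^ j)"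
  shows "(\<Prod>i<n * k. \<theta> - (\<theta> - 1 / t) ^ (q ^ i)) = poly twist_poly t ^ E"
proof -
  define x where "x = \<theta> - 1 / t"
  \<comment> \<open>Chosen so that \<open>(c i)^(q^i) = \<theta>\<close>, which turns
    \<open>\<theta> - x^(q^i)\<close> into \<open>(c i - x)^(q^i)\<close>.\<close>
  define c where "c = (\<lambda>i. \<theta> ^ (q ^ (n - i)))"
  have DE: "(q ^ n - 1) * E = q ^ (n * k) - 1"
    unfolding E using geometric_sum_nat[of "q ^ n" k] q_gt_1 by (simp add: power_mult)
  have c: "c i - x = (1 + (c i - \<theta>) * t) / t" for i
    using t by (simp add: x_def field_simps)
  have factor: "\<theta> - x ^ (q ^ (n * j + i)) = ((c i - x) ^ (q ^ i)) ^ ((q ^ n) ^ j)" if "i < n" for i j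
  proof -
    have "(c i) ^ (q ^ i) = \<theta>"
      using that by (simp add: c_def frob_frob \<theta>_frob)
    hence "((c i - x) ^ (q ^ i)) ^ (q ^ (n * j)) = \<theta> - x ^ (q ^ (i + n * j))"
      using frob_period[OF \<theta>_frob, of j] by (simp add: frob_diff frob_frob)
    thus ?thesis by (simp add: power_mult add.commute)
  qed
  have "(\<Prod>i<n * k. \<theta> - x ^ (q ^ i)) = (\<Prod>j<k. \<Prod>i<n. \<theta> - x ^ (q ^ (n * j + i)))"
    by (rule prod_lessThan_blocks)
  also have "\<dots> = (\<Prod>j<k. (\<Prod>i<n. (c i - x) ^ (q ^ i)) ^ ((q ^ n) ^ j))"
    by (intro prod.cong) (auto simp: factor prod_power_distrib)
  also have "\<dots> = (\<Prod>i<n. (c i - x) ^ (q ^ i)) ^ E"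
    unfolding E by (simp add: power_sum)
  also have "(\<Prod>i<n. (c i - x) ^ (q ^ i)) = (\<Prod>i<n. (1 + (c i - \<theta>) * t) ^ (q ^ i)) / t ^ (\<Sum>i<n. q ^ i)"
    by (simp add: c power_divide prod_dividef power_sum)
  also have "(\<Prod>i<n. (1 + (c i - \<theta>) * t) ^ (q ^ i)) = (\<Prod>i\<in>{1..<n}. (1 + (c i - \<theta>) * t) ^ (q ^ i))"
    using n_pos by (simp add: lessThan_atLeast0 prod.atLeast_Suc_lessThan c_def \<theta>_frob)
  \<comment> \<open>The denominator is raised to the exponent \<open>q^n - 1\<close>, so that its
    \<open>E\<close>-th power is \<open>t^(q^(n*k) - 1) = 1\<close>.\<close>
  also have "\<dots> / t ^ (\<Sum>i<n. q ^ i) = poly twist_poly t / t ^ (q ^ n - 1)"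
  proof -
    have "t ^ (q ^ n - 1) = t ^ ((q ^ n - 1) - (\<Sum>i<n. q ^ i)) * t ^ (\<Sum>i<n. q ^ i)"
      by (simp only: power_add[symmetric] le_add_diff_inverse2[OF sum_powers_le])
    thus ?thesis
      using t by (simp only:) (simp add: twist_poly_def poly_monom poly_prod c_def mult.commute)
  qed
  also have "\<dots> ^ E = poly twist_poly t ^ E / t ^ ((q ^ n - 1) * E)"
    by (simp add: power_divide power_mult)
  also have "t ^ ((q ^ n - 1) * E) = 1"
    unfolding DE using power_F t by simp
  finally show ?thesis by (simp add: x_def)
qed

text \<open>The exponents \<open>r = 2 * n * s\<close> make \<open>q^r\<close> a square, as
  Stepanov's method requires, and put \<open>\<theta>\<close> into \<open>F r\<close>. The
  substitution \<open>x = \<theta> - 1/t\<close> turns \<open>S r\<close> into the sum of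
  \<open>\<psi>\<close> over the values \<open>h t\<close>, whose fibres
  \<open>stepanov_bound\<close> controls.\<close>

theorem extension_sum_bound:
  "\<exists>C s\<^sub>0. \<forall>s\<ge>s\<^sub>0. norm (S (2 * n * s)) \<le> C * real (q ^ (n * s))"
proof -
  define D where "D = q ^ n - 1"
  define f where "f = twist_poly"
  define g where "g = D * degree f"
  have q1: "q ^ n > 1" using q_gt_1 n_pos by (metis one_less_power)
  hence D: "D > 0" by (simp add: D_def)
  have deg: "D = Suc (degree f)" using q1 by (simp add: D_def f_def degree_twist_poly)
  have "norm (S (2 * n * s)) \<le> real (2 * g + 2 + degree f) * real (q ^ (n * s))"
    if s: "s \<ge> g ^ 2 + 3 * g + 2" for s
  proof -
    define R where "R = q ^ (n * s)"
    define r where "r = n * (2 * s)"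
    define Q where "Q = q ^ r"
    define E where "E = (\<Sum>j<2 * s. (q ^ n) ^ j)"
    define h where "h = (\<lambda>t. poly f t ^ E)"
    \<comment> \<open>Stepanov's bound for a fibre of \<open>h\<close>. The main term
      \<open>Q\<close> of \<open>D * B\<close> will cancel against the number of \<open>t\<close>
      with \<open>h t \<noteq> 0\<close>, which is at least \<open>Q - degree f\<close>.\<close>
    define B where "B = real (Q + (2 * g + 1) * R) / real D"
    have r: "r > 0" "n dvd r" using s n_pos by (auto simp: r_def)
    have Q: "Q = R ^ 2" unfolding Q_def R_def r_def power_mult[symmetric] by (simp only: mult_ac)
    have DE: "D * E = Q - 1"
      unfolding D_def E_def Q_def r_def power_mult[of q n] by (rule geometric_sum_nat) (use q_gt_1 in simp)
    have Ediv: "E = (Q - 1) div D" unfolding DE[symmetric] using D by simp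
    have "s < q ^ s" using q_gt_1 by (simp add: power_gt_expt)
    also have "\<dots> \<le> R" unfolding R_def using q_gt_1 n_pos by (intro power_increasing) auto
    finally have R: "R > g ^ 2 + 3 * g + 1" using s by linarith
    obtain e where e: "R = CHAR('k) ^ e" using q_power_char R_def by blast
    have fin: "finite (F r)" by (rule finite_F[OF r(1)])
    have hF: "h t \<in> F n" if "t \<in> F r" for t
      unfolding h_def
    proof (rule power_F_in_subfield)
      show "poly f t \<in> F (n * (2 * s))" using poly_twist_poly_in[OF r(2) that] by (simp add: f_def r_def)
      show "E * (q ^ n - 1) = q ^ (n * (2 * s)) - 1"
        using DE by (simp add: D_def Q_def r_def mult.commute)
    qed
    have fibre: "real (card {t \<in> F r. h t = z}) \<le> B" if z: "z \<in> F n - {0}" for z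
    proof -
      have "D * card {x. x ^ Q = x \<and> poly f x ^ ((Q - 1) div D) = z} \<le> Q + (2 * g + 1) * R"
      proof (rule stepanov_bound[OF char e Q D])
        show "D dvd Q - 1" using DE by (metis dvd_triv_left)
        show "coprime D (degree f)" unfolding deg by (rule coprime_Suc_left_nat)
      qed (use z R in \<open>simp_all add: f_def twist_poly_nonzero g_def\<close>)
      also have "{x. x ^ Q = x \<and> poly f x ^ ((Q - 1) div D) = z} = {t \<in> F r. h t = z}"
        by (auto simp: F_iff Q_def h_def Ediv)
      finally have "real D * real (card {t \<in> F r. h t = z}) \<le> real (Q + (2 * g + 1) * R)"
        by (metis of_nat_le_iff of_nat_mult)
      thus ?thesis using D by (simp add: B_def field_simps)
    qed
    have sum: "norm (\<Sum>t\<in>F r. \<psi> (h t)) \<le> real D * B - real (card {t \<in> F r. h t \<noteq> 0})"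
      unfolding D_def by (rule sum_fibres_bound[OF fin hF fibre])
    have "Q - degree f \<le> card (F r - {t. poly f t = 0})"
    proof -
      have "card (F r) - card {t. poly f t = 0} \<le> card (F r - {t. poly f t = 0})"
        by (rule diff_card_le_card_Diff) (simp add: f_def twist_poly_nonzero poly_roots_finite)
      moreover have "card {t. poly f t = 0} \<le> degree f"
        by (rule card_poly_roots_bound) (simp add: f_def twist_poly_nonzero)
      ultimately show ?thesis using card_F[OF r(1)] by (simp add: Q_def)
    qed
    also have "\<dots> \<le> card {t \<in> F r. h t \<noteq> 0}"
      by (rule card_mono) (use fin in \<open>auto simp: h_def\<close>)
    finally have card: "real Q - real (degree f) \<le> real (card {t \<in> F r. h t \<noteq> 0})" by linarith
    \<comment> \<open>The point \<open>x = \<theta>\<close> is not of the form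
      \<open>\<theta> - 1/t\<close>; it contributes nothing, since the factor for
      \<open>i = 0\<close> vanishes.\<close>
    have "S r = (\<Sum>x\<in>F r - {\<theta>}. \<psi> (\<Prod>i<r. \<theta> - x ^ (q ^ i)))"
    proof -
      have "\<theta> \<in> F r" using F_mono_dvd[OF r(2)] \<theta>_in by blast
      moreover have "(\<Prod>i<r. \<theta> - \<theta> ^ (q ^ i)) = 0" using r by (intro prod_zero) force+
      hence "\<psi> (\<Prod>i<r. \<theta> - \<theta> ^ (q ^ i)) = 0" by (simp only: \<psi>_0)
      ultimately show ?thesis unfolding S_def using fin by (simp add: sum.remove[of _ \<theta>])
    qed
    also have "\<dots> = (\<Sum>t\<in>F r - {0}. \<psi> (h t))"
    proof (rule sum.reindex_bij_witness[where i = "\<lambda>t. \<theta> - 1 / t" and j = "\<lambda>x. 1 / (\<theta> - x)"])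
      have \<theta>: "\<theta> \<in> F r" using F_mono_dvd[OF r(2)] \<theta>_in by blast
      fix x assume x: "x \<in> F r - {\<theta>}"
      show t: "1 / (\<theta> - x) \<in> F r - {0}" using x \<theta> by (auto intro!: F_divide F_diff)
      show "\<theta> - 1 / (1 / (\<theta> - x)) = x" by simp
      have "(\<Prod>i<n * (2 * s). \<theta> - (\<theta> - 1 / (1 / (\<theta> - x))) ^ (q ^ i)) = poly twist_poly (1 / (\<theta> - x)) ^ E"
        by (rule norm_eq_twist_poly[OF _ _ E_def]) (use t r_def in auto)
      thus "\<psi> (h (1 / (\<theta> - x))) = \<psi> (\<Prod>i<r. \<theta> - x ^ (q ^ i))"
        by (simp add: h_def f_def r_def)
    next
      have \<theta>: "\<theta> \<in> F r" using F_mono_dvd[OF r(2)] \<theta>_in by blast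
      fix t assume t: "t \<in> F r - {0}"
      show "1 / (\<theta> - (\<theta> - 1 / t)) = t" by simp
      show "\<theta> - 1 / t \<in> F r - {\<theta>}" using t \<theta> by (auto intro!: F_divide F_diff)
    qed
    also have "\<dots> = (\<Sum>t\<in>F r. \<psi> (h t)) - \<psi> (h 0)"
      using fin by (simp add: sum.remove[of "F r" 0])
    finally have "norm (S r) \<le> norm (\<Sum>t\<in>F r. \<psi> (h t)) + norm (\<psi> (h 0))"
      by (simp only: norm_triangle_ineq4)
    also have "norm (\<psi> (h 0)) \<le> 1" by (rule \<psi>_le) (simp add: hF)
    also have "norm (\<Sum>t\<in>F r. \<psi> (h t)) \<le> real D * B - (real Q - real (degree f))"
      using sum card by linarith
    also have "real D * B = real Q + (2 * real g + 1) * real R"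
      using D by (simp add: B_def algebra_simps)
    finally have "norm (S r) \<le> (2 * real g + 1) * real R + (1 + real (degree f)) * 1" by simp
    also have "(1 + real (degree f)) * 1 \<le> (1 + real (degree f)) * real R"
      using R by (intro mult_left_mono) auto
    finally have "norm (S r) \<le> (2 * real g + 2 + real (degree f)) * real R" by (simp add: algebra_simps)
    thus ?thesis by (simp add: R_def r_def mult_ac add_ac)
  qed
  thus ?thesis by blast
qed

end

section \<open>Counting conjugates of roots\<close>

lemma order_smult_prod_mset:
  fixes c :: "'k::field"
  assumes "c \<noteq> 0"
  shows "order x (smult c (\<Prod>a\<in>#A. [:-a, 1:])) = count A x"
proof -
  have "order x (\<Prod>a\<in>#A. [:-a, 1:]) = count A x"
  proof (induction A)
    case (add a A)
    have nz: "(\<Prod>a\<in>#A. [:-a, 1:]) \<noteq> 0" by (auto simp: prod_mset_zero_iff)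
    have lin: "order x [:-a, 1:] = (if x = a then 1 else 0)"
      using order_power_n_n[of a 1] by (auto intro!: order_0I)
    have "order x ([:-a, 1:] * (\<Prod>a\<in>#A. [:-a, 1:])) = order x [:-a, 1:] + count A x"
      using nz by (subst order_mult) (auto simp: add simp del: mult_pCons_left)
    thus ?case by (simp add: lin del: mult_pCons_left)
  qed simp
  thus ?thesis using assms by (simp add: order_smult)
qed

lemma degree_eq_sum_order:
  fixes f :: "'k::alg_closed_field poly"
  assumes "f \<noteq> 0"
  shows "degree f = (\<Sum>x | poly f x = 0. order x f)"
proof -
  obtain A where A: "size A = degree f" "f = smult (lead_coeff f) (\<Prod>x\<in>#A. [:-x, 1:])"
    using alg_closed_imp_factorization[OF assms] by blast
  have ord: "order x f = count A x" for x
    by (subst A(2), rule order_smult_prod_mset) (use assms in simp)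
  have "{x. poly f x = 0} = set_mset A"
    using assms by (auto simp: order_root ord)
  thus ?thesis using A(1) by (simp add: ord size_multiset_overloaded_eq)
qed

lemma prod_linear_powers_dvd:
  fixes f :: "'k::field poly"
  assumes "finite Y" "f \<noteq> 0" "\<And>y. y \<in> Y \<Longrightarrow> e \<le> order y f"
  shows "(\<Prod>y\<in>Y. [:-y, 1:] ^ e) dvd f"
  using assms
proof (induction Y arbitrary: f rule: finite_induct)
  case (insert y Y)
  have "[:-y, 1:] ^ e dvd f" using insert.prems by (simp add: order_divides)
  then obtain g where g: "f = [:-y, 1:] ^ e * g" by (elim dvdE)
  have "e \<le> order z g" if "z \<in> Y" for z
  proof -
    have "order z ([:-y, 1:] ^ e) = 0"
      using that insert.hyps by (intro order_0I) (auto simp: poly_power)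
    moreover have "order z f = order z ([:-y, 1:] ^ e) + order z g"
      unfolding g using insert.prems(1) g by (intro order_mult) auto
    ultimately show ?thesis using insert.prems(2)[of z] that by simp
  qed
  hence "(\<Prod>y\<in>Y. [:-y, 1:] ^ e) dvd g" using insert.IH[of g] insert.prems(1) g by auto
  thus ?case unfolding g prod.insert[OF insert.hyps] by (rule mult_dvd_mono[OF dvd_refl])
qed simp

context finite_subfields
begin

section \<open>Frobenius acting on the coefficients of polynomials\<close>

definition frob_poly :: "'k poly \<Rightarrow> 'k poly" where
  "frob_poly f = map_poly (\<lambda>c. c ^ q) f"

lemma coeff_frob_poly: "coeff (frob_poly f) i = coeff f i ^ q"
  using q_gt_1 by (simp add: frob_poly_def coeff_map_poly zero_power)

lemma frob_poly_mult: "frob_poly (f * g) = frob_poly f * frob_poly g"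
  by (intro poly_eqI) (simp add: coeff_frob_poly coeff_mult power_mult_distrib frob_sum[where j = 1, simplified])

lemma frob_poly_1: "frob_poly 1 = 1"
  using q_gt_1 by (intro poly_eqI) (auto simp: coeff_frob_poly zero_power)

lemma frob_poly_prod: "frob_poly (\<Prod>a\<in>A. h a) = (\<Prod>a\<in>A. frob_poly (h a))"
  by (induction A rule: infinite_finite_induct) (simp_all add: frob_poly_1 frob_poly_mult)

lemma frob_poly_power: "frob_poly (f ^ k) = frob_poly f ^ k"
  by (induction k) (simp_all add: frob_poly_1 frob_poly_mult)

lemma frob_poly_linear: "frob_poly [:-a, 1:] = [:- (a ^ q), 1:]"
  using q_gt_1 frob_uminus[of a 1]
  by (intro poly_eqI) (auto simp: coeff_frob_poly coeff_pCons zero_power split: nat.splits)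

definition rational :: "'k poly \<Rightarrow> bool" where
  "rational f \<longleftrightarrow> frob_poly f = f"

lemma rational_iff: "rational f \<longleftrightarrow> (\<forall>i. coeff f i \<in> F 1)"
  by (simp add: rational_def poly_eq_iff coeff_frob_poly F_iff)

lemma rational_mult: "rational f \<Longrightarrow> rational g \<Longrightarrow> rational (f * g)"
  by (simp add: rational_def frob_poly_mult)

lemma rational_cancel:
  assumes "rational (f * g)" "rational f" "f \<noteq> 0" shows "rational g"
  using assms by (simp add: rational_def frob_poly_mult)

lemma poly_frob:
  assumes "rational f" shows "poly f x ^ (q ^ j) = poly f (x ^ (q ^ j))"
proof -
  have "coeff f i ^ (q ^ j) = coeff f i" for i
  proof -
    have "coeff f i \<in> F j" using assms F_mono_dvd[of 1 j] unfolding rational_iff by auto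
    thus ?thesis by (simp add: F_iff)
  qed
  thus ?thesis
    by (simp add: poly_altdef frob_sum power_mult_distrib) (simp add: power_mult[symmetric] mult.commute)
qed

lemma poly_rational_in: "rational f \<Longrightarrow> x \<in> F j \<Longrightarrow> poly f x \<in> F j"
  by (simp add: F_iff poly_frob)

text \<open>Applying Frobenius to the coefficients of \<open>f = (X - y)^e * g\<close> exhibits
  \<open>(X - y^q)^e\<close> as a factor of the same \<open>f\<close>.\<close>

lemma order_frob:
  assumes "rational f" "f \<noteq> 0" shows "order x f \<le> order (x ^ (q ^ i)) f"
proof (induction i)
  case (Suc i)
  have "order y f \<le> order (y ^ q) f" for y
  proof -
    have "[:-y, 1:] ^ order y f dvd f" by (rule order_1)
    then obtain g where "f = [:-y, 1:] ^ order y f * g" by (elim dvdE)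
    hence "frob_poly f = [:-(y ^ q), 1:] ^ order y f * frob_poly g"
      by (metis frob_poly_mult frob_poly_power frob_poly_linear)
    hence "[:-(y ^ q), 1:] ^ order y f dvd f" using assms(1) by (metis rational_def dvd_triv_left)
    thus ?thesis using assms(2) by (simp add: order_divides)
  qed
  from this[of "x ^ (q ^ i)"] Suc show ?case by (simp add: mult.commute flip: power_mult)
qed simp

text \<open>For \<open>j > 0\<close> and \<open>x\<close> in \<open>F j\<close> this is the
  characteristic polynomial of \<open>x\<close> over the field of \<open>q\<close> elements, a power
  of the minimal polynomial.\<close>

definition conj_poly :: "nat \<Rightarrow> 'k \<Rightarrow> 'k poly" where
  "conj_poly j x = (\<Prod>i<j. [:- (x ^ (q ^ i)), 1:])"

lemma conj_poly_nonzero: "conj_poly j x \<noteq> 0"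
  by (simp add: conj_poly_def)

lemma degree_conj_poly: "degree (conj_poly j x) = j"
  unfolding conj_poly_def by (subst degree_prod_eq_sum_degree) auto

lemma monic_conj_poly: "lead_coeff (conj_poly j x) = 1"
  unfolding conj_poly_def by (simp add: lead_coeff_prod)

lemma rational_conj_poly:
  assumes "x \<in> F j" shows "rational (conj_poly j x)"
proof (cases j)
  case (Suc k)
  define h where "h = (\<lambda>i. [:- (x ^ (q ^ i)), 1:])"
  have "frob_poly (conj_poly j x) = (\<Prod>i<j. h (Suc i))"
    unfolding conj_poly_def frob_poly_prod frob_poly_linear h_def
    by (simp add: mult.commute flip: power_mult)
  also have "\<dots> = (\<Prod>i<k. h (Suc i)) * h j" using Suc by simp
  also have "h j = h 0" using assms by (simp add: h_def F_iff)
  also have "(\<Prod>i<k. h (Suc i)) * h 0 = (\<Prod>i<j. h i)"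
    unfolding Suc prod.lessThan_Suc_shift by (simp add: mult.commute)
  finally show ?thesis by (simp add: rational_def conj_poly_def h_def)
qed (simp add: conj_poly_def rational_def frob_poly_1)

lemma orbit_period:
  assumes "x \<in> F j" "j > 0"
  obtains d where "d > 0" "\<And>i. x \<in> F i \<longleftrightarrow> d dvd i" "inj_on (\<lambda>i. x ^ (q ^ i)) {..<d}"
proof -
  define d where "d = (LEAST d. d > 0 \<and> x \<in> F d)"
  have d: "d > 0" "x \<in> F d"
    using LeastI[of "\<lambda>d. d > 0 \<and> x \<in> F d" j] assms by (auto simp: d_def)
  have least: "i = 0" if "x \<in> F i" "i < d" for i
    using that not_less_Least[of i "\<lambda>d. d > 0 \<and> x \<in> F d"] by (auto simp: d_def)
  show ?thesis
  proof
    show "d > 0" by fact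
    show "x \<in> F i \<longleftrightarrow> d dvd i" for i
    proof
      assume "x \<in> F i"
      hence "(x ^ (q ^ (d * (i div d)))) ^ (q ^ (i mod d)) = x"
        by (simp add: frob_frob F_iff)
      hence "x \<in> F (i mod d)" using d(2) by (simp add: F_iff frob_period)
      hence "i mod d = 0" using d(1) by (intro least) auto
      thus "d dvd i" by auto
    next
      assume "d dvd i" thus "x \<in> F i" using F_mono_dvd d(2) by blast
    qed
    have False if "i < k" "k < d" "x ^ (q ^ i) = x ^ (q ^ k)" for i k
    proof -
      have "(x ^ (q ^ (k - i))) ^ (q ^ i) = x ^ (q ^ i)"
        using that by (simp add: frob_frob)
      hence "x \<in> F (k - i)" using frob_inj by (simp add: F_iff)
      hence "k - i = 0" by (rule least) (use that in simp)
      thus False using that by simp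
    qed
    thus "inj_on (\<lambda>i. x ^ (q ^ i)) {..<d}"
      by (intro linorder_inj_onI) auto
  qed
qed

text \<open>The Frobenius orbit of a root stays among the finitely many roots, so two iterates
  agree; injectivity of Frobenius moves the coincidence back to \<open>x\<close>.\<close>

lemma root_in_some_F:
  assumes "rational f" "f \<noteq> 0" "poly f x = 0"
  shows "\<exists>j>0. x \<in> F j"
proof -
  have "poly f (x ^ (q ^ i)) = 0" for i
    using poly_frob[OF assms(1), of x i] assms(3) q_gt_1 by (simp add: zero_power)
  hence "range (\<lambda>i. x ^ (q ^ i)) \<subseteq> {y. poly f y = 0}" by auto
  hence "finite (range (\<lambda>i. x ^ (q ^ i)))"
    using poly_roots_finite[OF assms(2)] finite_subset by blast
  hence "\<not> inj (\<lambda>i. x ^ (q ^ i))" using finite_imageD by blast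
  then obtain i k where ik: "i < k" "x ^ (q ^ i) = x ^ (q ^ k)"
    unfolding inj_def by (metis linorder_neq_iff)
  have "(x ^ (q ^ (k - i))) ^ (q ^ i) = x ^ (q ^ i)"
    using ik by (simp add: frob_frob)
  hence "x \<in> F (k - i)" using frob_inj by (simp add: F_iff)
  thus ?thesis using ik by (intro exI[of _ "k - i"]) auto
qed

text \<open>If \<open>x\<close> has degree \<open>d\<close> over the field of \<open>q\<close>
  elements, the admissible \<open>j\<close> are multiples \<open>d * e\<close>, and
  \<open>conj_poly (d * e) x\<close> is the \<open>e\<close>-th power of the minimal polynomial. It
  divides \<open>f\<close> exactly when \<open>e \<le> order x f\<close>.\<close>

lemma card_conj_poly_dvd:
  assumes f: "rational f" "f \<noteq> 0" and x: "poly f x = 0"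
  shows "card {j. 0 < j \<and> x \<in> F j \<and> conj_poly j x dvd f} = order x f"
proof -
  obtain d where d: "d > 0" "\<And>i. x \<in> F i \<longleftrightarrow> d dvd i" "inj_on (\<lambda>i. x ^ (q ^ i)) {..<d}"
    using root_in_some_F[OF f x] orbit_period by metis
  have xd: "x ^ (q ^ d) = x" using d(2)[of d] by (simp add: F_iff)
  have split: "conj_poly (d * e) x = (\<Prod>y\<in>(\<lambda>i. x ^ (q ^ i)) ` {..<d}. [:-y, 1:] ^ e)" for e
  proof -
    have "x ^ (q ^ (d * j + i)) = x ^ (q ^ i)" for i j
      using frob_period[OF xd, of j] by (simp flip: frob_frob)
    hence "conj_poly (d * e) x = (\<Prod>j<e. \<Prod>i<d. [:- (x ^ (q ^ i)), 1:])"
      unfolding conj_poly_def prod_lessThan_blocks by simp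
    also have "\<dots> = (\<Prod>i<d. [:- (x ^ (q ^ i)), 1:] ^ e)"
      by (simp add: prod_power_distrib)
    finally show ?thesis by (simp add: prod.reindex[OF d(3)])
  qed
  have dvd: "conj_poly (d * e) x dvd f \<longleftrightarrow> e \<le> order x f" for e
  proof
    assume "e \<le> order x f"
    thus "conj_poly (d * e) x dvd f"
      unfolding split using order_frob[OF f, of x]
      by (intro prod_linear_powers_dvd f) (auto intro: le_trans)
  next
    assume *: "conj_poly (d * e) x dvd f"
    have "[:-x, 1:] ^ e dvd conj_poly (d * e) x"
      unfolding split by (intro dvd_prodI) (use d(1) in \<open>auto intro!: image_eqI[of _ _ 0]\<close>)
    hence "[:-x, 1:] ^ e dvd f" using * dvd_trans by blast
    thus "e \<le> order x f" using f by (simp add: order_divides)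
  qed
  have "{j. 0 < j \<and> x \<in> F j \<and> conj_poly j x dvd f} = (\<lambda>e. d * e) ` {1..order x f}"
  proof (intro equalityI subsetI)
    fix j assume j: "j \<in> {j. 0 < j \<and> x \<in> F j \<and> conj_poly j x dvd f}"
    hence "d dvd j" using d(2) by blast
    then obtain e where e: "j = d * e" by (elim dvdE)
    have "0 < e" "e \<le> order x f" using j dvd[of e] unfolding e by simp_all
    thus "j \<in> (\<lambda>e. d * e) ` {1..order x f}" unfolding e by (intro imageI) simp
  next
    fix j assume "j \<in> (\<lambda>e. d * e) ` {1..order x f}"
    then obtain e where e: "j = d * e" "e \<in> {1..order x f}" by blast
    have "x \<in> F (d * e)" using d(2) by simp
    thus "j \<in> {j. 0 < j \<and> x \<in> F j \<and> conj_poly j x dvd f}"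
      using e d(1) dvd[of e] by simp
  qed
  thus ?thesis using d(1) by (simp add: card_image inj_on_def)
qed

text \<open>Grouped by \<open>x\<close>, each root contributes its multiplicity, and the
  multiplicities add up to the degree.\<close>

lemma card_conj_poly_divisors:
  assumes f: "rational f" "f \<noteq> 0"
  shows "card {(j, x). j \<in> {1..degree f} \<and> x \<in> F j \<and> conj_poly j x dvd f} = degree f"
proof -
  define J where "J = (\<lambda>x. {j. 0 < j \<and> x \<in> F j \<and> conj_poly j x dvd f})"
  have le: "j \<le> degree f" if "conj_poly j x dvd f" for j x
    using dvd_imp_degree_le[OF that f(2)] by (simp add: degree_conj_poly)
  have root: "poly f x = 0" if "conj_poly j x dvd f" "j > 0" for j x
  proof -
    have "poly (conj_poly j x) x = 0" using that(2)
      unfolding conj_poly_def poly_prod by (intro prod_zero) force+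
    thus ?thesis using that(1) by (metis dvdE mult_zero_left poly_mult)
  qed
  have fin: "finite (J x)" for x
    by (rule finite_subset[of _ "{..degree f}"]) (auto simp: J_def le)
  have "{(j, x). j \<in> {1..degree f} \<and> x \<in> F j \<and> conj_poly j x dvd f}
      = prod.swap ` Sigma {x. poly f x = 0} J"
    using le root by (force simp: J_def Suc_le_eq image_iff)
  hence "card {(j, x). j \<in> {1..degree f} \<and> x \<in> F j \<and> conj_poly j x dvd f} =
      card (Sigma {x. poly f x = 0} J)"
    by (simp add: card_image)
  also have "\<dots> = (\<Sum>x | poly f x = 0. order x f)"
    using fin poly_roots_finite[OF f(2)]
    by (subst card_SigmaI) (auto simp: J_def card_conj_poly_dvd[OF f] intro!: sum.cong)
  also have "\<dots> = degree f" by (rule degree_eq_sum_order[OF f(2), symmetric])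
  finally show ?thesis .
qed

section \<open>Polynomials of given degree over the field of \<open>q\<close> elements\<close>

definition low_polys :: "nat \<Rightarrow> 'k poly set" where
  "low_polys k = {f. rational f \<and> (\<forall>i\<ge>k. coeff f i = 0)}"

definition monic_polys :: "nat \<Rightarrow> 'k poly set" where
  "monic_polys k = {f. rational f \<and> degree f = k \<and> lead_coeff f = 1}"

lemma low_polys_0: "low_polys 0 = {0}"
  by (auto simp: low_polys_def rational_iff poly_eq_iff)

lemma low_polys_Suc: "low_polys (Suc k) = (\<lambda>(a, f). pCons a f) ` (F 1 \<times> low_polys k)"
proof (intro equalityI subsetI)
  fix f assume f: "f \<in> low_polys (Suc k)"
  obtain a g where fg: "f = pCons a g" by (metis pCons_cases)
  have "a \<in> F 1" using f by (auto simp: low_polys_def rational_iff fg dest: spec[of _ 0])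
  moreover have "coeff g i = coeff f (Suc i)" for i by (simp add: fg)
  hence "g \<in> low_polys k" using f by (auto simp: low_polys_def rational_iff)
  ultimately show "f \<in> (\<lambda>(a, f). pCons a f) ` (F 1 \<times> low_polys k)" using fg by auto
qed (auto simp: low_polys_def rational_iff coeff_pCons split: nat.splits)

lemma card_low_polys: "finite (low_polys k) \<and> card (low_polys k) = q ^ k"
proof (induction k)
  case (Suc k)
  have "inj_on (\<lambda>(a, f). pCons a f) (F 1 \<times> low_polys k)" by (auto simp: inj_on_def)
  thus ?case using Suc finite_F[of 1] card_F[of 1]
    by (simp add: low_polys_Suc card_image card_cartesian_product)
qed (simp add: low_polys_0)

lemma rational_add: "rational f \<Longrightarrow> rational g \<Longrightarrow> rational (f + g)"
  and rational_diff: "rational f \<Longrightarrow> rational g \<Longrightarrow> rational (f - g)"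
  by (simp_all add: rational_iff F_add F_diff)

lemma monic_polys_conv: "monic_polys k = (\<lambda>f. f + monom 1 k) ` low_polys k"
proof (intro equalityI subsetI)
  fix f assume f: "f \<in> monic_polys k"
  have "f - monom 1 k \<in> low_polys k"
    using f coeff_eq_0[of f]
    by (auto simp: monic_polys_def low_polys_def rational_iff coeff_diff F_diff intro: F_diff)
  thus "f \<in> (\<lambda>f. f + monom 1 k) ` low_polys k" by (intro image_eqI[of _ _ "f - monom 1 k"]) auto
next
  fix f assume "f \<in> (\<lambda>f. f + monom 1 k) ` low_polys k"
  then obtain g where g: "f = g + monom 1 k" "g \<in> low_polys k" by blast
  have "degree f = k"
  proof (rule antisym)
    show "degree f \<le> k" using g by (intro degree_le) (auto simp: low_polys_def)
    show "k \<le> degree f" using g by (intro le_degree) (auto simp: low_polys_def)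
  qed
  moreover have "rational f" using g by (auto simp: low_polys_def rational_iff intro!: F_add)
  ultimately show "f \<in> monic_polys k" using g by (auto simp: monic_polys_def low_polys_def)
qed

lemma finite_monic_polys: "finite (monic_polys k)"
  using card_low_polys[of k] by (simp add: monic_polys_conv)

lemma monic_polys_dvd:
  assumes c: "c \<in> monic_polys j" and "j \<le> k"
  shows "{f \<in> monic_polys k. c dvd f} = (\<lambda>g. c * g) ` monic_polys (k - j)"
proof (intro equalityI subsetI)
  have nz: "c \<noteq> 0" using c by (auto simp: monic_polys_def)
  fix f assume f: "f \<in> {f \<in> monic_polys k. c dvd f}"
  then obtain g where g: "f = c * g" by blast
  have f': "f \<noteq> 0" using f by (auto simp: monic_polys_def)
  have "rational g" using f c g nz rational_cancel by (auto simp: monic_polys_def)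
  moreover have "lead_coeff f = lead_coeff c * lead_coeff g" unfolding g by (rule lead_coeff_mult)
  hence "lead_coeff g = 1" using f c by (auto simp: monic_polys_def)
  moreover have "degree f = degree c + degree g" unfolding g using nz f' g by (intro degree_mult_eq) auto
  ultimately have "g \<in> monic_polys (k - j)" using f c by (auto simp: monic_polys_def)
  thus "f \<in> (\<lambda>g. c * g) ` monic_polys (k - j)" using g by blast
next
  have nz: "c \<noteq> 0" using c by (auto simp: monic_polys_def)
  fix f assume "f \<in> (\<lambda>g. c * g) ` monic_polys (k - j)"
  then obtain g where g: "f = c * g" "g \<in> monic_polys (k - j)" by blast
  have "g \<noteq> 0" using g(2) by (auto simp: monic_polys_def)
  hence "degree f = degree c + degree g" unfolding g using nz by (intro degree_mult_eq)
  hence "degree f = k" using g c assms(2) by (auto simp: monic_polys_def)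
  moreover have "lead_coeff f = lead_coeff c * lead_coeff g" unfolding g by (rule lead_coeff_mult)
  hence "lead_coeff f = 1" using g(2) c by (auto simp: monic_polys_def)
  ultimately show "f \<in> {f \<in> monic_polys k. c dvd f}"
    using g(2) c rational_mult[of c g] unfolding g(1) by (simp add: monic_polys_def del: mult_pCons_left)
qed

end

section \<open>Power sums of complex numbers\<close>

text \<open>Simultaneous Diophantine approximation yields large exponents for which all powers have
  argument close to \<open>0\<close>. Then nothing cancels in the real part of the sum, which is at
  least half of \<open>norm w ^ (m * s)\<close>; this contradicts the bound if
  \<open>norm w > B\<close>.\<close>

lemma large_power_sums:
  fixes A :: "complex multiset" and C B :: real
  assumes bound: "\<And>s. s \<ge> s\<^sub>0 \<Longrightarrow> norm (\<Sum>w\<in>#A. w ^ (m * s)) \<le> C * B ^ (m * s)"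
    and "m > 0" "B > 0" "w \<in># A"
  shows "norm w \<le> B"
proof (rule ccontr)
  assume "\<not> norm w \<le> B"
  hence w: "norm w / B > 1" using assms by simp
  obtain ws where ws: "mset ws = A" by (metis ex_mset)
  obtain l where l: "(norm w / B) ^ l > 2 * C" using real_arch_pow[OF w] by blast
  \<comment> \<open>Ensures \<open>s \<ge> s\<^sub>0\<close> and \<open>s \<ge> l\<close> for
    whatever positive \<open>t\<close> the approximation returns.\<close>
  define K where "K = max 1 (max s\<^sub>0 l)"
  define \<alpha> where "\<alpha> = (\<lambda>i. real K * real m * Arg (ws ! i) / (2 * pi))"
  obtain t p where tp: "0 < t" "\<And>i. i < length ws \<Longrightarrow> \<bar>of_int t * \<alpha> i - of_int (p i)\<bar> < 1 / real 8"
    by (rule Dirichlet_approx_simult[of 8 "length ws" \<alpha>]) (simp, blast)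
  define s where "s = K * nat t"
  have "1 * 1 \<le> nat t" using tp(1) by simp
  hence sK: "s \<ge> K" unfolding s_def by (cases "nat t") auto
  have Re: "Re (v ^ (m * s)) \<ge> norm v ^ (m * s) / 2" if "v \<in> set ws" for v
  proof -
    have "\<exists>i<length ws. ws ! i = v" using that by (simp only: in_set_conv_nth)
    then obtain i where i: "i < length ws" "ws ! i = v" by (elim exE conjE)
    define x where "x = 2 * pi * (of_int t * \<alpha> i - of_int (p i))"
    have "x + 2 * pi * of_int (p i) = of_int t * (2 * pi * \<alpha> i)"
      unfolding x_def by (simp only: right_diff_distrib diff_add_cancel mult.left_commute)
    also have "2 * pi * \<alpha> i = real K * real m * Arg v"
      by (simp add: \<alpha>_def i(2))
    also have "of_int t * (real K * real m * Arg v) = (real m * (real K * of_int t)) * Arg v"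
      by (simp only: mult_ac)
    also have "real m * (real K * of_int t) = real (m * s)"
      using tp(1) by (simp add: s_def)
    finally have x: "real (m * s) * Arg v = x + 2 * pi * of_int (p i)" by (rule sym)
    have "\<bar>x\<bar> = 2 * pi * \<bar>of_int t * \<alpha> i - of_int (p i)\<bar>" by (simp add: x_def abs_mult)
    also have "\<dots> \<le> 2 * pi * (1 / 8)"
      using tp(2)[OF i(1)] by (intro mult_left_mono) auto
    \<comment> \<open>An error of \<open>1/8\<close> of a turn is an angle of \<open>pi / 4\<close>,
      relaxed to \<open>pi / 3\<close>, whose cosine is \<open>1/2\<close>.\<close>
    finally have "\<bar>x\<bar> \<le> pi / 3" by simp
    hence "cos (pi / 3) \<le> cos \<bar>x\<bar>" by (intro cos_monotone_0_pi_le) auto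
    hence cos: "cos x \<ge> 1 / 2" by (simp add: cos_60)
    have "v = rcis (norm v) (Arg v)" by (simp add: rcis_cmod_Arg)
    hence "v ^ (m * s) = rcis (norm v ^ (m * s)) (real (m * s) * Arg v)" by (metis DeMoivre2)
    hence "Re (v ^ (m * s)) = norm v ^ (m * s) * cos (x + 2 * pi * of_int (p i))"
      by (simp only: x Re_rcis)
    also have "cos (x + 2 * pi * of_int (p i)) = cos x"
      using sin_cos_eq_iff[of "x + 2 * pi * of_int (p i)" x] by auto
    finally show ?thesis using mult_left_mono[OF cos, of "norm v ^ (m * s)"] by simp
  qed
  have "norm w ^ (m * s) / 2 \<le> Re (w ^ (m * s))" using Re assms(4) ws by auto
  also have "\<dots> \<le> (\<Sum>v\<in>#A. Re (v ^ (m * s)))"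
  proof -
    obtain A' where A': "A = add_mset w A'" using assms(4) by (metis insert_DiffM)
    have "0 \<le> Re (v ^ (m * s))" if "v \<in># A'" for v
      using Re[of v] that ws A' by (metis (no_types, opaque_lifting) divide_nonneg_pos insert_iff
          norm_ge_zero order_trans set_mset_add_mset_insert set_mset_mset zero_le_power zero_less_numeral)
    hence "0 \<le> (\<Sum>v\<in>#A'. Re (v ^ (m * s)))"
      by (induction A') auto
    thus ?thesis by (simp add: A')
  qed
  also have "\<dots> = Re (\<Sum>v\<in>#A. v ^ (m * s))"
    by (induction A) auto
  also have "\<dots> \<le> C * B ^ (m * s)"
    using bound[of s] sK complex_Re_le_cmod[of "\<Sum>v\<in>#A. v ^ (m * s)"] by (auto simp: K_def)
  finally have "(norm w / B) ^ (m * s) \<le> 2 * C"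
    using assms(3) by (simp add: power_divide field_simps)
  moreover have "1 * l \<le> m * s" using sK assms(2) by (intro mult_le_mono) (auto simp: K_def)
  hence "(norm w / B) ^ l \<le> (norm w / B) ^ (m * s)" using w by (intro power_increasing) auto
  ultimately show False using l by linarith
qed

text \<open>Logarithmic derivative of the product of the \<open>1 - w X\<close>: each factor
  contributes \<open>- w X / (1 - w X)\<close>, the series with coefficients
  \<open>- w^j\<close>.\<close>

lemma fps_power_sums:
  fixes A :: "complex multiset"
  defines "L \<equiv> fps_of_poly (\<Prod>w\<in>#A. [:1, -w:])"
  shows "fps_X * fps_deriv L = L * Abs_fps (\<lambda>j. if j = 0 then 0 else - (\<Sum>w\<in>#A. w ^ j))"
  unfolding L_def
proof (induction A)
  case empty
  show ?case by (simp add: fps_eq_iff)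
next
  case (add v A)
  define L where "L = fps_of_poly (\<Prod>w\<in>#A. [:1, -w:])"
  define P where "P = Abs_fps (\<lambda>j. if j = 0 then 0 else - (\<Sum>w\<in>#A. w ^ j))"
  define G where "G = Abs_fps (\<lambda>j. if j = 0 then 0 else - (v ^ j))"
  define l where "l = 1 - fps_const v * fps_X"
  have lin: "fps_of_poly [:1, -v:] = l"
    by (simp add: l_def fps_of_poly_pCons fps_eq_iff)
  have G: "l * G = - (fps_const v * fps_X)"
  proof (rule fps_ext)
    fix j show "fps_nth (l * G) j = fps_nth (- (fps_const v * fps_X)) j"
      by (cases j) (auto simp: l_def G_def left_diff_distrib mult.assoc)
  qed
  have PG: "Abs_fps (\<lambda>j. if j = 0 then 0 else - (\<Sum>w\<in>#add_mset v A. w ^ j)) = P + G"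
    by (simp add: P_def G_def fps_eq_iff)
  have IH: "fps_X * fps_deriv L = L * P" using add unfolding L_def P_def .
  have "fps_X * fps_deriv (l * L) = - (fps_const v * fps_X) * L + l * (fps_X * fps_deriv L)"
    by (simp add: l_def algebra_simps)
  also have "\<dots> = (l * L) * (P + G)"
    unfolding IH G[symmetric] by (simp add: algebra_simps)
  finally show ?case unfolding PG by (simp add: fps_of_poly_mult lin L_def del: mult_pCons_left)
qed

lemma reflect_poly_prod_linear:
  "reflect_poly (\<Prod>w\<in>#A. [:-w, 1:]) = (\<Prod>w\<in>#A. [:1, -w :: 'c::field:])"
proof (induction A)
  case (add w A)
  have "reflect_poly [:-w, 1:] = [:1, -w:]"
    by (cases "w = 0") (simp_all add: reflect_poly_def)
  thus ?case using add by (simp add: reflect_poly_mult del: mult_pCons_left)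
qed simp

text \<open>The recursion \<open>newton\<close> says that \<open>X L' / L\<close> has coefficients
  \<open>S j\<close>, where \<open>L\<close> is the polynomial with coefficients \<open>a k\<close>.
  So \<open>S j\<close> is minus a power sum of at most \<open>n - 1\<close> reciprocal roots, and
  \<open>large_power_sums\<close> bounds each root by \<open>B\<close>.\<close>

lemma power_sums_bound:
  fixes a S :: "nat \<Rightarrow> complex" and B C :: real
  assumes a0: "a 0 = 1" and vanish: "\<And>k. k \<ge> n \<Longrightarrow> a k = 0"
    and newton: "\<And>k. of_nat k * a k = (\<Sum>j=1..k. S j * a (k - j))"
    and bound: "\<And>s. s \<ge> s\<^sub>0 \<Longrightarrow> norm (S (m * s)) \<le> C * B ^ (m * s)"
    and pos: "m > 0" "B > 0"
  shows "norm (S 1) \<le> real (n - 1) * B"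
proof -
  define L where "L = (\<Sum>k<n. monom (a k) k)"
  have coeff: "coeff L k = a k" for k
    using vanish[of k] by (auto simp: L_def coeff_sum coeff_monom if_distrib cong: if_cong)
  have L: "L \<noteq> 0" using a0 coeff[of 0] by auto
  have deg: "degree L \<le> n - 1"
    using vanish by (intro degree_le) (auto simp: coeff)
  have "lead_coeff (reflect_poly L) = 1" by (simp add: a0 coeff coeff_reflect_poly)
  then obtain A where A: "size A = degree (reflect_poly L)" "reflect_poly L = (\<Prod>w\<in>#A. [:-w, 1:])"
    using alg_closed_imp_factorization[of "reflect_poly L"] L by auto
  have "size A \<le> n - 1" using A(1) deg degree_reflect_poly_le[of L] by linarith
  have L_eq: "L = (\<Prod>w\<in>#A. [:1, -w:])"
    using A(2) reflect_poly_prod_linear[of A] reflect_poly_reflect_poly[of L] a0 coeff[of 0] by simp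
  define \<sigma> where "\<sigma> = Abs_fps (\<lambda>j. if j = 0 then 0 else S j)"
  have \<sigma>: "fps_X * fps_deriv (fps_of_poly L) = fps_of_poly L * \<sigma>"
  proof (rule fps_ext)
    fix k
    have "fps_nth (fps_of_poly L * \<sigma>) k = (\<Sum>j=0..k. (if j = 0 then 0 else S j) * a (k - j))"
      by (subst mult.commute) (simp add: fps_mult_nth \<sigma>_def coeff)
    also have "\<dots> = (\<Sum>j=1..k. S j * a (k - j))"
      by (simp add: sum.atLeast_Suc_atMost)
    also have "\<dots> = of_nat k * a k" by (rule newton[symmetric])
    also have "\<dots> = fps_nth (fps_X * fps_deriv (fps_of_poly L)) k"
      by (cases k) (simp_all add: coeff)
    finally show "fps_nth (fps_X * fps_deriv (fps_of_poly L)) k = fps_nth (fps_of_poly L * \<sigma>) k" ..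
  qed
  define P where "P = Abs_fps (\<lambda>j. if j = 0 then 0 else - (\<Sum>w\<in>#A. w ^ j))"
  have "fps_X * fps_deriv (fps_of_poly L) = fps_of_poly L * P"
    unfolding L_eq P_def by (rule fps_power_sums)
  hence "fps_of_poly L * \<sigma> = fps_of_poly L * P" using \<sigma> by (rule trans[OF sym, rotated])
  moreover have "fps_of_poly L \<noteq> 0" using L by simp
  ultimately have "\<sigma> = P" by (metis mult_left_cancel)
  hence nth: "fps_nth \<sigma> j = fps_nth P j" for j by (simp only:)
  have S: "S j = - (\<Sum>w\<in>#A. w ^ j)" if "j > 0" for j
    using nth[of j] that by (simp add: \<sigma>_def P_def)
  have roots: "norm w \<le> B" if "w \<in># A" for w
  proof (rule large_power_sums[OF _ pos that])
    \<comment> \<open>The case \<open>s = 0\<close> is excluded, since \<open>S\<close> agrees with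
      the power sums only at positive indices.\<close>
    fix s assume "s \<ge> max s\<^sub>0 1"
    thus "norm (\<Sum>w\<in>#A. w ^ (m * s)) \<le> C * B ^ (m * s)"
      using bound[of s] S[of "m * s"] pos by simp
  qed
  have "norm (S 1) = norm (\<Sum>w\<in>#A. w)" using S[of 1] by simp
  also have "\<dots> \<le> real (size A) * B"
    using roots
  proof (induction A)
    case (add w A)
    have "norm (w + \<Sum>\<^sub># A) \<le> norm w + norm (\<Sum>\<^sub># A)" by (rule norm_triangle_ineq)
    thus ?case using add by (simp add: algebra_simps) (smt (verit))
  qed simp
  also have "\<dots> \<le> real (n - 1) * B"
    using \<open>size A \<le> n - 1\<close> pos by (intro mult_right_mono) auto
  finally show ?thesis .
qed

section \<open>The L-function\<close>

context subfield_character
begin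

text \<open>Coefficient of \<open>T^k\<close> in the L-function, the sum of
  \<open>\<psi>(f(\<theta>)) T^(deg f)\<close> over monic \<open>f\<close>.\<close>

definition L_coeff :: "nat \<Rightarrow> complex" where
  "L_coeff k = (\<Sum>f\<in>monic_polys k. \<psi> (poly f \<theta>))"

lemma L_coeff_0: "L_coeff 0 = 1"
proof -
  have "monic_polys 0 = {1}"
    by (auto simp: monic_polys_conv low_polys_0)
  thus ?thesis by (simp add: L_coeff_def \<psi>_1)
qed

text \<open>A nonzero polynomial of degree below \<open>n\<close> over the field of \<open>q\<close>
  elements cannot vanish at the \<open>n\<close> distinct conjugates of \<open>\<theta>\<close>;
  surjectivity follows by counting.\<close>

lemma low_polys_bij: "bij_betw (\<lambda>p. poly p \<theta>) (low_polys n) (F n)"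
proof -
  have inj: "inj_on (\<lambda>p. poly p \<theta>) (low_polys n)"
  proof (rule inj_onI)
    fix f g assume fg: "f \<in> low_polys n" "g \<in> low_polys n" "poly f \<theta> = poly g \<theta>"
    define h where "h = f - g"
    have h: "rational h" "poly h \<theta> = 0" "\<forall>i\<ge>n. coeff h i = 0"
      using fg by (auto simp: h_def low_polys_def rational_diff)
    obtain d where d: "\<And>i. \<theta> \<in> F i \<longleftrightarrow> d dvd i" "inj_on (\<lambda>i. \<theta> ^ (q ^ i)) {..<d}" "d > 0"
      using orbit_period[OF \<theta>_in n_pos] by metis
    have "d = n"
    proof (rule ccontr)
      assume "d \<noteq> n"
      moreover have "d \<le> n" using d(1)[of n] \<theta>_in n_pos by (auto intro: dvd_imp_le)
      ultimately show False using \<theta>_proper[of d] d(1)[of d] d(3) by simp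
    qed
    have "h = 0"
    proof (rule ccontr)
      assume nz: "h \<noteq> 0"
      have "n = card ((\<lambda>i. \<theta> ^ (q ^ i)) ` {..<n})"
        using d(2) \<open>d = n\<close> by (simp add: card_image)
      also have "\<dots> \<le> card {x. poly h x = 0}"
        using nz h q_gt_1
        by (intro card_mono poly_roots_finite) (auto simp: zero_power simp flip: poly_frob[OF h(1)])
      also have "\<dots> \<le> degree h" by (rule card_poly_roots_bound[OF nz])
      also have "degree h < n"
        using h(3) nz by (meson leading_coeff_neq_0 not_le)
      finally show False by simp
    qed
    thus "f = g" by (simp add: h_def)
  qed
  have "(\<lambda>p. poly p \<theta>) ` low_polys n \<subseteq> F n"
    using \<theta>_in by (auto simp: low_polys_def intro: poly_rational_in)
  moreover have "card ((\<lambda>p. poly p \<theta>) ` low_polys n) = card (F n)"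
    using inj card_low_polys[of n] card_F[OF n_pos] by (simp add: card_image)
  ultimately have "(\<lambda>p. poly p \<theta>) ` low_polys n = F n"
    using finite_F[OF n_pos] by (intro card_subset_eq)
  thus ?thesis using inj by (simp add: bij_betw_def)
qed

text \<open>Adding a polynomial of degree below \<open>n\<close> permutes the monic polynomials of
  degree \<open>k \<ge> n\<close>, and such shifts move the value at \<open>\<theta>\<close> through
  all of \<open>F n\<close>. Averaging over them leaves the full sum of \<open>\<psi>\<close>, which
  is zero.\<close>

lemma L_coeff_vanish:
  assumes "k \<ge> n" shows "L_coeff k = 0"
proof -
  have shift: "L_coeff k = (\<Sum>f\<in>monic_polys k. \<psi> (poly f \<theta> + poly p \<theta>))" if p: "p \<in> low_polys n" for p
  proof -
    have mono: "f + g \<in> low_polys k" "f - g \<in> low_polys k" if "f \<in> low_polys k" "g \<in> low_polys n" for f g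
      using that assms by (auto simp: low_polys_def rational_add rational_diff)
    have "f + p \<in> monic_polys k" "f - p \<in> monic_polys k" if f: "f \<in> monic_polys k" for f
    proof -
      obtain g where g: "f = g + monom 1 k" "g \<in> low_polys k" using f by (auto simp: monic_polys_conv)
      have "f + p = (g + p) + monom 1 k" "f - p = (g - p) + monom 1 k" by (simp_all add: g)
      thus "f + p \<in> monic_polys k" "f - p \<in> monic_polys k"
        unfolding monic_polys_conv using mono[OF g(2) p] by blast+
    qed
    thus ?thesis unfolding L_coeff_def
      by (intro sum.reindex_bij_witness[where i = "\<lambda>f. f + p" and j = "\<lambda>f. f - p"]) auto
  qed
  have "of_nat (q ^ n) * L_coeff k = (\<Sum>p\<in>low_polys n. L_coeff k)"
    using card_low_polys[of n] by simp
  also have "\<dots> = (\<Sum>p\<in>low_polys n. \<Sum>f\<in>monic_polys k. \<psi> (poly f \<theta> + poly p \<theta>))"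
    by (intro sum.cong refl shift)
  also have "\<dots> = (\<Sum>f\<in>monic_polys k. \<Sum>p\<in>low_polys n. \<psi> (poly f \<theta> + poly p \<theta>))"
    by (rule sum.swap)
  also have "\<dots> = (\<Sum>f\<in>monic_polys k. \<Sum>y\<in>F n. \<psi> (poly f \<theta> + y))"
    by (intro sum.cong refl sum.reindex_bij_betw[OF low_polys_bij])
  also have "\<dots> = (\<Sum>f\<in>monic_polys k. 0)"
  proof (intro sum.cong refl)
    fix f assume "f \<in> monic_polys k"
    hence f: "poly f \<theta> \<in> F n" using \<theta>_in by (auto simp: monic_polys_def intro: poly_rational_in)
    have "(\<Sum>y\<in>F n. \<psi> (poly f \<theta> + y)) = (\<Sum>y\<in>F n. \<psi> y)"
      using f by (intro sum.reindex_bij_witness[where i = "\<lambda>y. y - poly f \<theta>" and j = "\<lambda>y. poly f \<theta> + y"])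
         (auto intro: F_add F_diff)
    thus "(\<Sum>y\<in>F n. \<psi> (poly f \<theta> + y)) = 0" by (simp add: \<psi>_sum)
  qed
  finally show ?thesis using q_gt_1 by simp
qed

lemma conj_poly_monic: "x \<in> F j \<Longrightarrow> conj_poly j x \<in> monic_polys j"
  using monic_conj_poly[of j x] by (simp add: monic_polys_def rational_conj_poly degree_conj_poly)

text \<open>A monic polynomial of degree \<open>k\<close> is counted \<open>k\<close> times, once for every divisor of the form
  \<open>\<Prod>\<^bsub>i<j\<^esub> (X - x\<^bsup>q\<^sup>i\<^esup>)\<close>; this is the logarithmic derivative of the Euler product.\<close>

lemma L_coeff_newton: "of_nat k * L_coeff k = (\<Sum>j=1..k. S j * L_coeff (k - j))"
proof -
  define I where "I = (SIGMA j:{1..k}. F j)"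
  have finI: "finite I" unfolding I_def by (intro finite_SigmaI) (auto intro: finite_F)
  have inner: "(\<Sum>f | f \<in> monic_polys k \<and> conj_poly j x dvd f. \<psi> (poly f \<theta>)) =
      \<psi> (\<Prod>i<j. \<theta> - x ^ (q ^ i)) * L_coeff (k - j)" if "j \<in> {1..k}" "x \<in> F j" for j x
  proof -
    have c: "conj_poly j x \<in> monic_polys j" by (rule conj_poly_monic[OF that(2)])
    have "(\<Sum>f | f \<in> monic_polys k \<and> conj_poly j x dvd f. \<psi> (poly f \<theta>)) =
      (\<Sum>f\<in>(\<lambda>g. conj_poly j x * g) ` monic_polys (k - j). \<psi> (poly f \<theta>))"
      using monic_polys_dvd[OF c, of k] that by simp
    also have "\<dots> = (\<Sum>g\<in>monic_polys (k - j). \<psi> (poly (conj_poly j x * g) \<theta>))"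
      by (subst sum.reindex) (auto simp: inj_on_def conj_poly_nonzero)
    also have "\<dots> = (\<Sum>g\<in>monic_polys (k - j). \<psi> (poly (conj_poly j x) \<theta>) * \<psi> (poly g \<theta>))"
    proof (intro sum.cong refl)
      fix g assume g: "g \<in> monic_polys (k - j)"
      show "\<psi> (poly (conj_poly j x * g) \<theta>) = \<psi> (poly (conj_poly j x) \<theta>) * \<psi> (poly g \<theta>)"
        unfolding poly_mult using g c \<theta>_in
        by (intro \<psi>_mult poly_rational_in) (auto simp: monic_polys_def)
    qed
    also have "poly (conj_poly j x) \<theta> = (\<Prod>i<j. \<theta> - x ^ (q ^ i))"
      by (simp add: conj_poly_def poly_prod)
    finally show ?thesis by (simp add: L_coeff_def sum_distrib_left)
  qed
  have "of_nat k * L_coeff k = (\<Sum>f\<in>monic_polys k. of_nat k * \<psi> (poly f \<theta>))"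
    by (simp add: L_coeff_def sum_distrib_left)
  also have "\<dots> = (\<Sum>f\<in>monic_polys k. \<Sum>(j, x) | (j, x) \<in> I \<and> conj_poly j x dvd f. \<psi> (poly f \<theta>))"
  proof (intro sum.cong refl)
    fix f assume f: "f \<in> monic_polys k"
    have "{(j, x). (j, x) \<in> I \<and> conj_poly j x dvd f} =
        {(j, x). j \<in> {1..degree f} \<and> x \<in> F j \<and> conj_poly j x dvd f}"
      using f by (auto simp: I_def monic_polys_def)
    moreover have "f \<noteq> 0" using f by (auto simp: monic_polys_def)
    hence "card {(j, x). j \<in> {1..degree f} \<and> x \<in> F j \<and> conj_poly j x dvd f} = k"
      using f card_conj_poly_divisors[of f] by (auto simp: monic_polys_def)
    ultimately show "of_nat k * \<psi> (poly f \<theta>) =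
        (\<Sum>(j, x) | (j, x) \<in> I \<and> conj_poly j x dvd f. \<psi> (poly f \<theta>))"
      by (simp add: case_prod_unfold)
  qed
  also have "\<dots> = (\<Sum>f\<in>monic_polys k. \<Sum>u | u \<in> I \<and> conj_poly (fst u) (snd u) dvd f. \<psi> (poly f \<theta>))"
    by (simp add: case_prod_unfold)
  \<comment> \<open>With the pair \<open>(j, x)\<close> fixed first, \<open>f\<close> runs over the
    multiples of \<open>conj_poly j x\<close>, that is, its products with monic polynomials of
    degree \<open>k - j\<close>.\<close>
  also have "\<dots> = (\<Sum>u\<in>I. \<Sum>f | f \<in> monic_polys k \<and> conj_poly (fst u) (snd u) dvd f. \<psi> (poly f \<theta>))"
    by (rule sum.swap_restrict[OF finite_monic_polys finI])
  also have "\<dots> = (\<Sum>(j, x)\<in>I. \<psi> (\<Prod>i<j. \<theta> - x ^ (q ^ i)) * L_coeff (k - j))"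
    by (intro sum.cong refl) (auto simp: I_def inner case_prod_unfold)
  also have "\<dots> = (\<Sum>j=1..k. \<Sum>x\<in>F j. \<psi> (\<Prod>i<j. \<theta> - x ^ (q ^ i)) * L_coeff (k - j))"
    unfolding I_def by (subst sum.Sigma) (auto intro: finite_F)
  also have "\<dots> = (\<Sum>j=1..k. S j * L_coeff (k - j))"
    by (simp add: S_def sum_distrib_right)
  finally show ?thesis .
qed

text \<open>Up to the sign of the summation variable the sum is \<open>S 1\<close>, and along
  \<open>r = 2 * n * s\<close> the bound on \<open>S r\<close> is a constant times
  \<open>sqrt q ^ r\<close>.\<close>

theorem weil_bound: "norm (\<Sum>a\<in>F 1. \<psi> (a + \<theta>)) \<le> real (n - 1) * sqrt (real q)"
proof -
  obtain C s\<^sub>0 where C: "\<And>s. s \<ge> s\<^sub>0 \<Longrightarrow> norm (S (2 * n * s)) \<le> C * real (q ^ (n * s))"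
    using extension_sum_bound by blast
  have sq: "sqrt (real q) ^ (2 * n * s) = real (q ^ (n * s))" for s
    by (simp add: mult.assoc power_mult)
  have "norm (S 1) \<le> real (n - 1) * sqrt (real q)"
    by (rule power_sums_bound[where a = L_coeff and m = "2 * n" and s\<^sub>0 = s\<^sub>0 and C = C])
       (use L_coeff_0 L_coeff_vanish L_coeff_newton C sq n_pos q_gt_1 in \<open>auto simp del: of_nat_power\<close>)
  moreover have "S 1 = (\<Sum>a\<in>F 1. \<psi> (a + \<theta>))"
    unfolding S_def
    by (intro sum.reindex_bij_witness[where i = uminus and j = uminus]) (auto intro: F_uminus)
  ultimately show ?thesis by simp
qed

end

section \<open>Finite fields and the sieve\<close>

lemma finite_field_power_card_minus_1:
  fixes y :: "'a::{finite,field}"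
  assumes "y \<noteq> 0"
  shows "y ^ (CARD('a) - 1) = 1"
proof -
  have "(\<Prod>z\<in>UNIV - {0}. y * z) = (\<Prod>z\<in>UNIV - {0}. z)"
    by (rule prod.reindex_bij_witness[of _ "\<lambda>z. z / y" "\<lambda>z. y * z"]) (use assms in auto)
  moreover have "(\<Prod>z\<in>UNIV - {0}. y * z) = y ^ (CARD('a) - 1) * (\<Prod>z\<in>UNIV - {0}. z)"
    by (simp add: prod.distrib)
  ultimately show ?thesis by simp
qed

lemma finite_field_generator:
  "\<exists>\<gamma>::'a::{finite,field}. \<gamma> \<noteq> 0 \<and> (\<forall>y. y \<noteq> 0 \<longrightarrow> (\<exists>i. \<gamma> ^ i = y))"
proof -
  define R where "R = (ring_of_type_algebra :: 'a ring)"
  interpret R: Ring.field R unfolding R_def by rule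
  have carr: "carrier R = UNIV" and zero: "\<zero>\<^bsub>R\<^esub> = 0"
    by (simp_all add: R_def ring_of_type_algebra_def)
  have pow: "x [^]\<^bsub>R\<^esub> (i::nat) = x ^ i" for x :: 'a and i
    by (induction i) (simp_all add: R_def ring_of_type_algebra_def nat_pow_def mult.commute)
  have mult: "carrier (Multiplicative_Group.mult_of R) = UNIV - {0}" by (simp add: carr zero)
  have "finite (carrier R)" by (simp add: carr)
  from R.finite_field_mult_group_has_gen[OF this]
  have "\<exists>\<gamma>\<in>UNIV - {0::'a}. UNIV - {0} = {\<gamma> ^ i | i::nat. i \<in> UNIV}"
    unfolding mult pow .
  then obtain \<gamma> :: 'a where \<gamma>: "\<gamma> \<in> UNIV - {0}" "UNIV - {0} = {\<gamma> ^ i | i::nat. i \<in> UNIV}"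
    by (rule bexE) (rule that)
  have "\<exists>i. \<gamma> ^ i = y" if "y \<noteq> 0" for y
  proof -
    have "y \<in> UNIV - {0}" using that by simp
    hence "y \<in> {\<gamma> ^ i | i::nat. i \<in> UNIV}" by (rule subst[OF \<gamma>(2)])
    thus ?thesis by (elim CollectE exE conjE) (rule exI, erule sym)
  qed
  thus ?thesis using \<gamma>(1) by (intro exI[of _ \<gamma>]) simp
qed

lemma discrete_log_exists:
  "\<exists>(\<gamma>::'a::{finite,field}) dlog. \<gamma> \<noteq> 0 \<and> (\<forall>y. y \<noteq> 0 \<longrightarrow> \<gamma> ^ dlog y = y) \<and>
     (\<forall>k l. \<gamma> ^ k = \<gamma> ^ l \<longleftrightarrow> [k = l] (mod (CARD('a) - 1)))"
proof -
  define N where "N = CARD('a) - 1"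
  obtain \<gamma> :: 'a where \<gamma>: "\<gamma> \<noteq> 0" "\<And>y. y \<noteq> 0 \<Longrightarrow> \<exists>i. \<gamma> ^ i = y"
    using finite_field_generator by blast
  have N: "card (UNIV - {0::'a}) = N" by (simp add: N_def)
  have "1 \<in> UNIV - {0::'a}" by simp
  hence "N > 0" using N by (metis card_gt_0_iff empty_iff finite)
  have mod: "\<gamma> ^ k = \<gamma> ^ (k mod N)" for k
  proof -
    have "\<gamma> ^ k = \<gamma> ^ (N * (k div N) + k mod N)" by simp
    also have "\<dots> = \<gamma> ^ (k mod N)"
      unfolding power_add power_mult using finite_field_power_card_minus_1[OF \<gamma>(1)] by (simp add: N_def)
    finally show ?thesis .
  qed
  have "UNIV - {0} = (\<lambda>i. \<gamma> ^ i) ` {..<N}"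
  proof (intro equalityI subsetI)
    fix y assume "y \<in> UNIV - {0::'a}"
    then obtain i where "\<gamma> ^ i = y" using \<gamma>(2)[of y] by auto
    thus "y \<in> (\<lambda>i. \<gamma> ^ i) ` {..<N}" using \<open>N > 0\<close> mod[of i] by (intro image_eqI[of _ _ "i mod N"]) auto
  qed (use \<gamma>(1) in auto)
  hence "inj_on (\<lambda>i. \<gamma> ^ i) {..<N}" using N by (intro eq_card_imp_inj_on) auto
  hence "\<gamma> ^ k = \<gamma> ^ l \<longleftrightarrow> [k = l] (mod N)" for k l
    unfolding cong_def using mod[of k] mod[of l] \<open>N > 0\<close> by (auto simp: inj_on_def)
  moreover have "\<exists>dlog. \<forall>y. y \<noteq> 0 \<longrightarrow> \<gamma> ^ dlog y = y"
    using \<gamma>(2) by metis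
  ultimately show ?thesis using \<gamma>(1) unfolding N_def by blast
qed

lemma power_eq_1_cong:
  fixes w :: "'b::field"
  assumes "w ^ N = 1" "[k = l] (mod N)"
  shows "w ^ k = w ^ l"
proof -
  have "w ^ k = w ^ (k mod N)" for k
  proof -
    have "w ^ k = w ^ (N * (k div N) + k mod N)" by simp
    thus ?thesis unfolding power_add power_mult assms(1) by simp
  qed
  from this[of k] this[of l] show ?thesis using assms(2) by (simp add: cong_def)
qed

section \<open>Passage to the algebraic closure\<close>

lemma CHAR_eq_prime:
  assumes "prime p" "card (UNIV :: 'a::{finite,field} set) = p ^ e"
  shows "CHAR('a) = p"
proof -
  have "CHAR('a) > 0" by (rule finite_imp_CHAR_pos) simp
  hence "prime CHAR('a)" by (rule prime_CHAR_semidom)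
  moreover have "CHAR('a) dvd p ^ e" using CHAR_dvd_CARD[where 'a = 'a] assms(2) by simp
  ultimately show ?thesis using assms(1) by (metis prime_dvd_power primes_dvd_imp_eq)
qed

text \<open>Moves the setting into the algebraic closure, where the extensions of every degree live
  inside one type.\<close>

lemma finite_field_embedding:
  fixes F :: "nat \<Rightarrow> 'a::{finite,field} alg_closure set"
  assumes q: "prime p" "k > 0" "q = p ^ k" and card: "card (UNIV :: 'a set) = q ^ n" and n: "n > 0"
    and F_def: "F = (\<lambda>j. {x. x ^ (q ^ j) = x})"
  shows "finite_subfields q F"
    and "to_ac x \<in> F j \<longleftrightarrow> x \<in> subfield_pow q j"
    and "F n = range to_ac"
    and "F 1 = to_ac ` subfield_pow q 1"
proof -
  have char: "CHAR('a) = p"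
    using CHAR_eq_prime[OF q(1)] card q(3) by (metis power_mult)
  show "finite_subfields q F"
    by unfold_locales (use q char in \<open>auto simp: F_def\<close>)
  then interpret finite_subfields q F .
  have pow: "x ^ (q ^ n) = x" for x :: 'a
  proof (cases "x = 0")
    case False
    have "x ^ (q ^ n - 1 + 1) = x"
      unfolding power_add using finite_field_power_card_minus_1[OF False] by (simp only: card) simp
    thus ?thesis using q_gt_1 by simp
  qed (use q_gt_1 in simp)
  show to_ac_F: "to_ac x \<in> F j \<longleftrightarrow> x \<in> subfield_pow q j" for x j
    by (simp add: F_def subfield_pow_def flip: to_ac_power)
  show Fn: "F n = range to_ac"
  proof (rule card_subset_eq[symmetric])
    show "range to_ac \<subseteq> F n" using pow by (auto simp: to_ac_F subfield_pow_def)
    show "card (range (to_ac :: 'a \<Rightarrow> _)) = card (F n)"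
      using card_F[OF n] card by (simp add: card_image inj_to_ac)
  qed (rule finite_F[OF n])
  have "F 1 \<subseteq> range to_ac" unfolding Fn[symmetric] by (rule F_mono_dvd) simp
  thus "F 1 = to_ac ` subfield_pow q 1" using to_ac_F[of _ 1] by (auto simp: image_iff)
qed

lemma card_subfield_pow_1:
  assumes "prime p" "k > 0" "q = p ^ k" "card (UNIV :: 'a::{finite,field} set) = q ^ n" "n > 0"
  shows "card (subfield_pow q 1 :: 'a set) = q"
proof -
  define F where "F = (\<lambda>j. {x :: 'a alg_closure. x ^ (q ^ j) = x})"
  note emb = finite_field_embedding[OF assms F_def]
  interpret finite_subfields q F by (rule emb(1))
  have "card (F 1) = card (subfield_pow q 1 :: 'a set)"
    unfolding emb(4) by (intro card_image inj_on_subset[OF inj_to_ac]) simp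
  thus ?thesis using card_F[of 1] by simp
qed

lemma weil_bound_finite_field:
  fixes \<beta> :: "'a::{finite,field}" and \<psi> :: "'a \<Rightarrow> complex"
  assumes q: "prime p" "k > 0" "q = p ^ k" and card: "card (UNIV :: 'a set) = q ^ n" and n: "n > 0"
    and proper: "\<And>d. d dvd n \<Longrightarrow> d < n \<Longrightarrow> \<beta> \<notin> subfield_pow q d"
    and hom: "\<And>x y. \<psi> (x * y) = \<psi> x * \<psi> y" "\<psi> 0 = 0" "\<psi> 1 = 1"
    and le: "\<And>x. norm (\<psi> x) \<le> 1" and sum: "(\<Sum>x\<in>UNIV. \<psi> x) = 0"
  shows "norm (\<Sum>a\<in>subfield_pow q 1. \<psi> (a + \<beta>)) \<le> real (n - 1) * sqrt (real q)"
proof -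
  define F where "F = (\<lambda>j. {x :: 'a alg_closure. x ^ (q ^ j) = x})"
  note emb = finite_field_embedding[OF q card n F_def]
  interpret finite_subfields q F by (rule emb(1))
  interpret subfield_character q F n "to_ac \<beta>" "\<lambda>z. \<psi> (of_ac z)"
  proof unfold_locales
    show "to_ac \<beta> \<in> F n" by (simp add: emb(3))
    show "to_ac \<beta> \<notin> F d" if "0 < d" "d < n" for d
    proof
      \<comment> \<open>The hypothesis \<open>proper\<close> concerns divisors of \<open>n\<close>
        only. The degree \<open>e\<close> of \<open>\<beta>\<close> over the field of
        \<open>q\<close> elements is such a divisor and is at most \<open>d\<close>.\<close>
      assume d: "to_ac \<beta> \<in> F d"
      obtain e where e: "e > 0" "\<And>i. to_ac \<beta> \<in> F i \<longleftrightarrow> e dvd i"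
        using orbit_period[OF d \<open>0 < d\<close>] by metis
      have "e dvd n" using e(2)[of n] by (simp add: emb(3))
      moreover have "e \<le> d" using e(2)[of d] d \<open>0 < d\<close> by (auto intro: dvd_imp_le)
      moreover have "to_ac \<beta> \<in> F e" using e(2) by simp
      ultimately show False using proper[of e] \<open>d < n\<close> by (simp add: emb(2))
    qed
    show "(\<Sum>z\<in>F n. \<psi> (of_ac z)) = 0"
      unfolding emb(3) by (simp add: sum.reindex inj_to_ac sum)
  qed (use n le hom in \<open>auto simp: emb(3) simp flip: to_ac_mult\<close>)
  have "(\<Sum>a\<in>F 1. \<psi> (of_ac (a + to_ac \<beta>))) = (\<Sum>a\<in>subfield_pow q 1. \<psi> (a + \<beta>))"
    unfolding emb(4) by (subst sum.reindex) (auto intro: inj_on_subset[OF inj_to_ac] simp flip: to_ac_add)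
  thus ?thesis using weil_bound by simp
qed

section \<open>Roots of unity and squarefree divisors\<close>

lemma sum_roots_of_unity_power:
  fixes l k :: nat
  assumes "l > 0"
  shows "(\<Sum>w | w ^ l = 1. w ^ k) = (if l dvd k then of_nat l else (0::complex))"
proof (cases "l dvd k")
  case True
  have "w ^ k = 1" if "w ^ l = 1" for w :: complex
    using True that by (auto simp: power_mult elim!: dvdE)
  thus ?thesis using True card_roots_unity_eq[OF assms] by simp
next
  case False
  define z where "z = cis (2 * pi / real l)"
  have z: "z ^ l = 1"
  proof -
    have "z ^ l = cis (real l * (2 * pi / real l))" unfolding z_def by (rule Complex.DeMoivre)
    also have "real l * (2 * pi / real l) = 2 * pi" using assms by simp
    finally show ?thesis by simp
  qed
  have zk: "z ^ k \<noteq> 1"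
  proof
    assume "z ^ k = 1"
    have "z ^ k = cis (real k * (2 * pi / real l))" unfolding z_def by (rule Complex.DeMoivre)
    also have "\<dots> = exp (2 * of_real pi * \<i> * of_nat k / of_nat l)"
      by (simp add: cis_conv_exp algebra_simps)
    finally have "z ^ k = exp (2 * of_real pi * \<i> * of_nat k / of_nat l)" .
    thus False using \<open>z ^ k = 1\<close> False complex_root_unity_eq_1[of l k] assms by simp
  qed
  have z0: "z \<noteq> 0" by (simp add: z_def)
  \<comment> \<open>Multiplication by \<open>z\<close> permutes the roots of unity and multiplies
    the sum by \<open>z^k \<noteq> 1\<close>.\<close>
  have "(\<Sum>w | w ^ l = 1. w ^ k) = (\<Sum>w | w ^ l = 1. (z * w) ^ k)"
    by (rule sum.reindex_bij_witness[of _ "\<lambda>w. z * w" "\<lambda>w. w / z"])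
       (use z z0 in \<open>auto simp: power_mult_distrib power_divide\<close>)
  also have "\<dots> = z ^ k * (\<Sum>w | w ^ l = 1. w ^ k)"
    by (simp add: power_mult_distrib sum_distrib_left)
  finally show ?thesis using zk False by simp
qed

text \<open>Raising to the product \<open>t\<close> of the other primes removes every factor but
  \<open>w l\<close>; since \<open>t\<close> is prime to \<open>l\<close>,
  \<open>w l ^ t = 1\<close> would force \<open>w l = 1\<close>.\<close>

lemma prod_roots_of_unity_neq_1:
  fixes w :: "nat \<Rightarrow> complex"
  assumes A: "finite A" "l \<in> A" "\<And>l. l \<in> A \<Longrightarrow> prime l" and w: "\<And>l. l \<in> A \<Longrightarrow> w l ^ l = 1" "w l \<noteq> 1"
  shows "(\<Prod>l\<in>A. w l) \<noteq> 1"
proof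
  assume prod: "(\<Prod>l\<in>A. w l) = 1"
  define t where "t = (\<Prod>l'\<in>A - {l}. l')"
  have "w l' ^ t = 1" if "l' \<in> A - {l}" for l'
  proof -
    have "l' dvd t" unfolding t_def using A(1) that by (intro dvd_prodI) auto
    thus ?thesis using w(1)[of l'] that by (auto simp: power_mult elim!: dvdE)
  qed
  hence rest: "(\<Prod>l'\<in>A - {l}. w l' ^ t) = 1" by (intro prod.neutral ballI)
  have "1 = (\<Prod>l'\<in>A. w l') ^ t" by (simp add: prod)
  also have "\<dots> = (\<Prod>l'\<in>A. w l' ^ t)" by (rule prod_power_distrib)
  also have "\<dots> = w l ^ t" by (simp only: prod.remove[OF A(1,2)] rest mult_1_right)
  finally have wt: "1 = w l ^ t" .
  have "coprime l t" unfolding t_def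
    using A by (intro prod_coprime_right primes_coprime) auto
  then obtain x y where xy: "t * x = l * y + 1"
    using coprime_bezout_strong[of t l] not_prime_1 A(2,3) by (metis coprime_commute)
  have "w l ^ (t * x) = w l ^ (l * y + 1)" by (simp add: xy)
  hence "1 = w l" unfolding power_add power_mult by (simp only: wt[symmetric] w(1)[OF A(2)] power_one mult_1_left power_one_right)
  thus False using w(2) by simp
qed

text \<open>Products over sets of prime factors are squarefree divisors, and the set is recovered
  from the product.\<close>

lemma W_ge:
  assumes "m > 0" shows "2 ^ card (prime_factors m) \<le> W m"
proof -
  define h where "h = (\<lambda>A::nat set. \<Prod>A)"
  have pf: "prime_factors (h A) = A" if "A \<subseteq> prime_factors m" for A
  proof -
    have fin: "finite A" using that finite_subset by blast
    have pr: "prime l" if "l \<in> A" for l using \<open>A \<subseteq> prime_factors m\<close> that by auto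
    have "0 \<notin> id ` A" using pr by (metis id_apply image_iff not_prime_0)
    have "prime_factors (h A) = (\<Union>l\<in>A. prime_factors l)"
      using prime_factors_prod[OF fin \<open>0 \<notin> id ` A\<close>] by (simp add: h_def o_def)
    also have "\<dots> = (\<Union>l\<in>A. {l})"
      using pr by (intro SUP_cong refl) (simp add: prime_factorization_prime)
    finally show ?thesis by simp
  qed
  have "inj_on h (Pow (prime_factors m))" by (rule inj_on_inverseI[of _ prime_factors]) (auto simp: pf)
  hence "card (Pow (prime_factors m)) = card (h ` Pow (prime_factors m))" by (simp add: card_image)
  also have "\<dots> \<le> card {d. d dvd m \<and> squarefree d}"
  proof (rule card_mono)
    show "finite {d. d dvd m \<and> squarefree d}" using assms by simp
    show "h ` Pow (prime_factors m) \<subseteq> {d. d dvd m \<and> squarefree d}"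
    proof
      fix d assume "d \<in> h ` Pow (prime_factors m)"
      then obtain A where A: "d = h A" "A \<subseteq> prime_factors m" by blast
      have fin: "finite A" using A finite_subset by blast
      have pr: "prime l" "l dvd m" if "l \<in> A" for l using that A by auto
      have "d dvd m" unfolding A(1) h_def
        using fin pr
      proof (induction A rule: finite_induct)
        case (insert l A)
        have "coprime l (\<Prod>A)"
          using insert by (intro prod_coprime_right primes_coprime) auto
        thus ?case using insert by (simp add: divides_mult)
      qed simp
      moreover have "squarefree d" unfolding A(1) h_def
        using fin pr by (intro squarefree_prod_coprime) (auto intro: primes_coprime squarefree_prime)
      ultimately show "d \<in> {d. d dvd m \<and> squarefree d}" by simp
    qed
  qed
  finally show ?thesis by (simp add: card_Pow W_def)
qed

theorem theorem7p3:
  fixes q n m :: nat and \<beta> :: "'a::{finite, field_gcd}"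
  assumes q_pp: "\<exists>p k. prime p \<and> k > 0 \<and> q = p ^ k"
    and card: "card (UNIV :: 'a set) = q ^ n"
    and n4: "n \<ge> 4"
    and m_pos: "m > 0"
    and m_dvd: "m dvd q ^ n - 1"
    and two_normal: "k_normal q n 2 \<beta>"
    and not_sub: "\<forall>d. d dvd n \<and> d < n \<longrightarrow> \<beta> \<notin> subfield_pow q d"
    and bound: "sqrt (real q) \<ge> real (n - 1) * real (W m)"
  shows "card {a \<in> subfield_pow q 1. m_free m (a + \<beta>)} > 0"
proof (rule ccontr)
  assume no_free: "\<not> card {a \<in> subfield_pow q 1. m_free m (a + \<beta>)} > 0"
  obtain p k where q: "prime p" "k > 0" "q = p ^ k" using q_pp by blast
  define N where "N = q ^ n - 1"
  define K where "K = (subfield_pow q 1 :: 'a set)"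
  define P where "P = prime_factors m"
  define Z where "Z = (\<lambda>l::nat. {w::complex. w ^ l = 1} - {1})"
  have "q > 1" using q prime_gt_1_nat by (metis one_less_power)
  have P: "prime l" "l dvd m" "l dvd N" if "l \<in> P" for l
    using that m_dvd by (auto simp: P_def N_def intro: dvd_trans)
  obtain \<gamma> :: 'a and dlog where \<gamma>: "\<gamma> \<noteq> 0" "\<And>y. y \<noteq> 0 \<Longrightarrow> \<gamma> ^ dlog y = y"
    "\<And>i j. \<gamma> ^ i = \<gamma> ^ j \<longleftrightarrow> [i = j] (mod N)"
    using discrete_log_exists[where 'a = 'a] unfolding card N_def by blast
  have dlog_mult: "[dlog (x * y) = dlog x + dlog y] (mod N)" if "x \<noteq> 0" "y \<noteq> 0" for x y
    unfolding \<gamma>(3)[symmetric] power_add using that \<gamma>(2) by simp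

  \<comment> \<open>Otherwise \<open>\<beta> = -a\<close> would lie in the field of \<open>q\<close>
    elements, excluded by \<open>not_sub\<close> with \<open>d = 1\<close>.\<close>
  have nz: "a + \<beta> \<noteq> 0" if a: "a \<in> K" for a
  proof
    assume "a + \<beta> = 0"
    hence \<beta>: "\<beta> = 0 - a" by (simp add: eq_neg_iff_add_eq_0 add.commute)
    have "CHAR('a) = p" using CHAR_eq_prime[OF q(1)] card q(3) by (metis power_mult)
    hence "(0 - a) ^ q = 0 ^ q - a ^ q" using q by (intro frobenius_diff[of _ k]) auto
    hence "\<beta> \<in> subfield_pow q 1" using a \<open>q > 1\<close> unfolding \<beta> by (simp add: K_def subfield_pow_def)
    thus False using not_sub n4 by (metis one_dvd less_le_trans numeral_One one_less_numeral_iff semiring_norm(76))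
  qed

  have weil: "norm (\<Sum>a\<in>K. w ^ dlog (a + \<beta>)) \<le> real (n - 1) * sqrt (real q)"
    if w: "w ^ N = 1" "w \<noteq> 1" for w :: complex
  proof -
    \<comment> \<open>The character sending the generator \<open>\<gamma>\<close> to
      \<open>w\<close>; it is nontrivial because \<open>w \<noteq> 1\<close>.\<close>
    define \<psi> where "\<psi> = (\<lambda>y. if y = 0 then 0 else w ^ dlog y)"
    have norm_w: "norm w = 1"
    proof -
      have "N > 0" using one_less_power[OF \<open>q > 1\<close>, of n] n4 by (simp add: N_def)
      moreover have "norm w ^ N = 1 ^ N" using w(1) by (simp flip: norm_power)
      ultimately show ?thesis by (intro power_eq_imp_eq_base[of "norm w" N 1]) auto
    qed
    have mult: "\<psi> (x * y) = \<psi> x * \<psi> y" for x y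
      using power_eq_1_cong[OF w(1) dlog_mult[of x y]] by (auto simp: \<psi>_def power_add)
    have "[dlog 1 = 0] (mod N)" unfolding \<gamma>(3)[symmetric] using \<gamma>(2)[of 1] by simp
    hence one: "\<psi> 1 = 1" using power_eq_1_cong[OF w(1), of "dlog 1" 0] by (simp add: \<psi>_def)
    have "[dlog \<gamma> = 1] (mod N)" unfolding \<gamma>(3)[symmetric] using \<gamma>(1,2) by simp
    hence gen: "\<psi> \<gamma> = w" using power_eq_1_cong[OF w(1), of "dlog \<gamma>" 1] \<gamma>(1) by (simp add: \<psi>_def)
    have "(\<Sum>x\<in>UNIV. \<psi> x) = (\<Sum>x\<in>UNIV. \<psi> (\<gamma> * x))"
      by (rule sum.reindex_bij_witness[of _ "\<lambda>x. \<gamma> * x" "\<lambda>x. x / \<gamma>"]) (use \<gamma>(1) in auto)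
    also have "\<dots> = w * (\<Sum>x\<in>UNIV. \<psi> x)" by (simp add: mult gen sum_distrib_left)
    finally have "(\<Sum>x\<in>UNIV. \<psi> x) = 0" using w(2) by simp
    hence "norm (\<Sum>a\<in>K. \<psi> (a + \<beta>)) \<le> real (n - 1) * sqrt (real q)"
      unfolding K_def
      by (intro weil_bound_finite_field[OF q card _ _ mult])
         (use n4 not_sub one norm_w in \<open>auto simp: \<psi>_def norm_power\<close>)
    moreover have "(\<Sum>a\<in>K. \<psi> (a + \<beta>)) = (\<Sum>a\<in>K. w ^ dlog (a + \<beta>))"
      using nz by (intro sum.cong refl) (simp add: \<psi>_def)
    ultimately show ?thesis by simp
  qed

  have finP: "finite P" by (simp add: P_def)
  have finZ: "finite (Z l)" and cardZ: "card (Z l) = l - 1" if "l \<in> P" for l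
  proof -
    have l: "l > 0" using P(1)[OF that] by (rule prime_gt_0_nat)
    show "finite (Z l)" using finite_roots_unity[of l] l by (simp add: Z_def)
    show "card (Z l) = l - 1" unfolding Z_def using card_roots_unity_eq[OF l] by (subst card_Diff_singleton) auto
  qed
  define B where "B = real (n - 1) * sqrt (real q)"
  \<comment> \<open>\<open>g l y + 1\<close> is \<open>0\<close> if \<open>l\<close> divides
    \<open>dlog y\<close>, as the sum is then \<open>l - 1\<close>. For \<open>y \<noteq> 0\<close>
    and \<open>l\<close> in \<open>P\<close> this happens exactly when \<open>y\<close> is an
    \<open>l\<close>-th power.\<close>
  define g where "g = (\<lambda>l y. - (1 / of_nat (l - 1)) * (\<Sum>w\<in>Z l. w ^ dlog y))"
  define T where "T = (\<lambda>A. \<Sum>a\<in>K. \<Prod>l\<in>A. g l (a + \<beta>))"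
  have vanish: "(\<Prod>l\<in>P. g l (a + \<beta>) + 1) = 0" if a: "a \<in> K" for a
  proof -
    have "\<not> m_free m (a + \<beta>)" using no_free a by (auto simp: K_def card_gt_0_iff)
    then obtain \<eta> d where \<eta>: "d > 0" "d dvd m" "a + \<beta> = \<eta> ^ d" "d \<noteq> 1"
      using nz[OF a] unfolding m_free_def by blast
    obtain l where l: "prime l" "l dvd d" using prime_factor_nat[OF \<eta>(4)] by blast
    have lP: "l \<in> P" using l \<eta>(2) m_pos by (auto simp: P_def prime_factors_dvd intro: dvd_trans)
    have "\<eta> \<noteq> 0" using \<eta>(1,3) nz[OF a] by (auto simp: zero_power)
    hence "\<gamma> ^ (dlog \<eta> * d) = \<gamma> ^ dlog (a + \<beta>)"
      using \<gamma>(2)[of \<eta>] \<gamma>(2)[OF nz[OF a]] \<eta>(3) by (simp add: power_mult)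
    hence "[dlog \<eta> * d = dlog (a + \<beta>)] (mod N)" by (simp only: \<gamma>(3))
    hence "[dlog \<eta> * d = dlog (a + \<beta>)] (mod l)" using P(3)[OF lP] by (rule cong_dvd_modulus_nat)
    hence dvd: "l dvd dlog (a + \<beta>)" using l(2) by (metis cong_dvd_iff dvd_mult)
    have l1: "l > 1" using l(1) by (rule prime_gt_1_nat)
    have "(\<Sum>w\<in>Z l. w ^ dlog (a + \<beta>)) = (\<Sum>w | w ^ l = 1. w ^ dlog (a + \<beta>)) - 1"
      unfolding Z_def using finite_roots_unity[of l] l1 by (subst sum_diff1) auto
    also have "\<dots> = of_nat (l - 1)"
      using sum_roots_of_unity_power[of l "dlog (a + \<beta>)"] dvd l1 by (simp add: of_nat_diff)
    finally have "g l (a + \<beta>) + 1 = 0" using l1 by (simp add: g_def)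
    thus ?thesis using lP finP by (intro prod_zero) auto
  qed
  have T_bound: "norm (T A) \<le> B" if A: "A \<subseteq> P" "A \<noteq> {}" for A
  proof -
    have finA: "finite A" using A(1) finP finite_subset by blast
    \<comment> \<open>Expanding the product gives one character sum for each choice \<open>v\<close>
      of roots of unity; the number of choices is the reciprocal of \<open>norm c\<close>, so only a
      single \<open>B\<close> remains.\<close>
    define c where "c = (\<Prod>l\<in>A. - (1 / of_nat (l - 1)) :: complex)"
    have "T A = (\<Sum>a\<in>K. c * (\<Sum>v\<in>PiE A Z. (\<Prod>l\<in>A. v l) ^ dlog (a + \<beta>)))"
      unfolding T_def
    proof (rule sum.cong[OF refl])
      fix a
      have "(\<Prod>l\<in>A. \<Sum>w\<in>Z l. w ^ dlog (a + \<beta>)) = (\<Sum>v\<in>PiE A Z. \<Prod>l\<in>A. v l ^ dlog (a + \<beta>))"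
        using finA finZ A(1) by (intro prod_sum_PiE) auto
      thus "(\<Prod>l\<in>A. g l (a + \<beta>)) = c * (\<Sum>v\<in>PiE A Z. (\<Prod>l\<in>A. v l) ^ dlog (a + \<beta>))"
        by (simp only: g_def prod.distrib c_def prod_power_distrib)
    qed
    also have "\<dots> = c * (\<Sum>v\<in>PiE A Z. \<Sum>a\<in>K. (\<Prod>l\<in>A. v l) ^ dlog (a + \<beta>))"
      by (subst sum.swap) (simp add: sum_distrib_left)
    finally have "norm (T A) = norm c * norm (\<Sum>v\<in>PiE A Z. \<Sum>a\<in>K. (\<Prod>l\<in>A. v l) ^ dlog (a + \<beta>))"
      by (simp only: norm_mult)
    also have "\<dots> \<le> norm c * (\<Sum>v\<in>PiE A Z. B)"
    proof (intro mult_left_mono sum_norm_le norm_ge_zero)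
      fix v assume v: "v \<in> PiE A Z"
      have vl: "v l ^ l = 1" "v l \<noteq> 1" if "l \<in> A" for l
        using v that by (auto simp: Z_def dest: PiE_mem)
      obtain l where l: "l \<in> A" using A(2) by blast
      have "(\<Prod>l\<in>A. v l) \<noteq> 1"
        using A(1) P(1) vl l by (intro prod_roots_of_unity_neq_1[OF finA l]) auto
      moreover have "v l ^ N = 1" if "l \<in> A" for l
      proof -
        obtain e where "N = l * e" using P(3) A(1) \<open>l \<in> A\<close> by (metis dvdE subsetD)
        thus ?thesis using vl(1)[OF that] by (simp add: power_mult)
      qed
      hence "(\<Prod>l\<in>A. v l) ^ N = 1" by (simp add: prod_power_distrib)
      ultimately show "norm (\<Sum>a\<in>K. (\<Prod>l\<in>A. v l) ^ dlog (a + \<beta>)) \<le> B"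
        unfolding B_def by (intro weil)
    qed
    also have "\<dots> = (norm c * (\<Prod>l\<in>A. real (l - 1))) * B"
    proof -
      have "card (PiE A Z) = (\<Prod>l\<in>A. l - 1)"
        unfolding card_PiE[OF finA] using A(1) cardZ by (intro prod.cong) auto
      thus ?thesis by simp
    qed
    also have "norm c = (\<Prod>l\<in>A. 1 / real (l - 1))"
      unfolding c_def prod_norm[symmetric]
      by (intro prod.cong refl) (simp only: norm_minus_cancel norm_divide norm_one norm_of_nat)
    also have "(\<Prod>l\<in>A. 1 / real (l - 1)) * (\<Prod>l\<in>A. real (l - 1)) = 1"
    proof -
      have "(\<Prod>l\<in>A. 1 / real (l - 1) * real (l - 1)) = 1"
      proof (intro prod.neutral ballI)
        fix l assume "l \<in> A"
        hence "l > 1" using A(1) P(1) prime_gt_1_nat by blast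
        thus "1 / real (l - 1) * real (l - 1) = 1" by simp
      qed
      thus ?thesis by (simp only: prod.distrib)
    qed
    finally show ?thesis by simp
  qed
  \<comment> \<open>Since no \<open>a\<close> gives an \<open>m\<close>-free element, every product
    vanishes; the main term \<open>q\<close> of the empty set must be balanced by the other
    subsets.\<close>
  have "0 = (\<Sum>a\<in>K. \<Prod>l\<in>P. g l (a + \<beta>) + 1)" using vanish by simp
  also have "\<dots> = (\<Sum>a\<in>K. \<Sum>A\<in>Pow P. \<Prod>l\<in>A. g l (a + \<beta>))"
    by (simp add: prod_add[OF finP])
  also have "\<dots> = (\<Sum>A\<in>Pow P. T A)" unfolding T_def by (rule sum.swap)
  also have "\<dots> = T {} + (\<Sum>A\<in>Pow P - {{}}. T A)"
    using finP by (intro sum.remove) auto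
  also have "T {} = of_nat q"
    using card_subfield_pow_1[OF q card] n4 by (simp add: T_def K_def)
  finally have "of_nat q + (\<Sum>A\<in>Pow P - {{}}. T A) = 0" by (rule sym)
  hence "of_nat q = - (\<Sum>A\<in>Pow P - {{}}. T A)" by (simp only: eq_neg_iff_add_eq_0)
  hence "norm (of_nat q :: complex) = norm (\<Sum>A\<in>Pow P - {{}}. T A)" by (simp only: norm_minus_cancel)
  hence "real q = norm (\<Sum>A\<in>Pow P - {{}}. T A)" by (simp only: norm_of_nat)
  also have "\<dots> \<le> (\<Sum>A\<in>Pow P - {{}}. B)" by (intro sum_norm_le T_bound) auto
  also have "\<dots> = (2 ^ card P - 1) * B" using finP by (simp add: card_Pow of_nat_diff)
  also have "\<dots> \<le> (real (W m) - 1) * B"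
  proof -
    have "real (2 ^ card P) \<le> real (W m)" using W_ge[OF m_pos] unfolding P_def of_nat_le_iff .
    thus ?thesis by (intro mult_right_mono) (auto simp: B_def)
  qed
  \<comment> \<open>Strict because \<open>B > 0\<close>: the \<open>- 1\<close>, which comes from
    leaving out the empty set, rules out equality.\<close>
  also have "\<dots> < real (W m) * real (n - 1) * sqrt (real q)"
    using n4 \<open>q > 1\<close> by (simp add: B_def algebra_simps)
  also have "\<dots> \<le> sqrt (real q) * sqrt (real q)"
    using bound by (intro mult_right_mono) (auto simp: mult.commute)
  also have "\<dots> = real q" by simp
  finally show False by simp
qed

end
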